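(* Let $n\ge 2$ and let $\varphi:\Delta_n\to\mathbb{R}$ be a smooth exponentially concave function such that the Euclidean Hessian of $e^{\varphi}$ is strictly negative definite everywhere on $\Delta_n$. Let $(g,\nabla,\nabla^* )$ be the geometric structure on $\Delta_n$ induced by the L-divergence of $\varphi$, and let $R$ and $R^*$ be the Riemann-Christoffel curvature tensors of the primal connection $\nabla$ and the dual connection $\nabla^*$ respectively. (i) In primal coordinates $\theta$, the coefficients of $R$ are $R_{ijk}^{\ell}(\theta)=\delta_{\ell j}\,g_{ik}(\theta)-\delta_{\ell i}\,g_{jk}(\theta)$, where $g_{ij}(\theta)$ are the coefficients of $g$ in primal coordinates. (ii) In dual coordinates $\phi$, the coefficients of $R^*$ are $R_{ijk}^{*\ell}(\phi)=\delta_{\ell j}\,g^*_{ik}(\phi)-\delta_{\ell i}\,g^*_{jk}(\phi)$, where $g^*_{ij}(\phi)$ are the coefficients of $g$ in dual coordinates. In particular, for $n\ge 3$ both $R$ and $R^*$ are nonzero everywhere on $\Delta_n$.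
   Context: $\Delta_n=\{p\in\mathbb{R}^n: p_i>0,\ \sum_{i=1}^n p_i=1\}$, a smooth $(n-1)$-dimensional manifold. $\nabla\varphi(p)\cdot v$ denotes the directional derivative of $\varphi$ at $p$ along $v\in\mathbb{R}^n$ with $\sum_i v_i=0$; definiteness of the Hessian is with respect to nonzero such $v$. $\varphi$ is exponentially concave if $e^{\varphi}$ is concave. L-divergence: $T(q\mid p)=\log(1+\nabla\varphi(p)\cdot(q-p))-(\varphi(q)-\varphi(p))$. Portfolio map: $\boldsymbol\pi_i(p)=p_i\big(1+\nabla\varphi(p)\cdot(e^{(i)}-p)\big)$, $1\le i\le n$; it maps $\Delta_n$ into $\Delta_n$. Primal coordinates: $\theta_i=\log(p_i/p_n)$; dual coordinates: $\phi_i=\theta_i-\log\frac{\boldsymbol\pi_i(p)}{\boldsymbol\pi_n(p)}$, $1\le i\le n-1$ ($p\mapsto\phi$ is a diffeomorphism onto an open subset of $\mathbb{R}^{n-1}$). Geometric structure: in any coordinate system $\xi$ of $\Delta_n$, the metric is $-\partial_{\xi_i}\partial_{\xi'_j}T(\xi\mid\xi')|_{\xi=\xi'}$; primal connection: $\Gamma_{ijk}(\xi)=-\partial_{\xi_i}\partial_{\xi_j}\partial_{\xi'_k}T(\xi\mid\xi')|_{\xi=\xi'}$; dual connection: $\Gamma^*_{ijk}(\xi)=-\partial_{\xi_k}\partial_{\xi'_i}\partial_{\xi'_j}T(\xi\mid\xi')|_{\xi=\xi'}$; the last index is raised with the inverse metric: $\Gamma_{ij}^k=\sum_m\Gamma_{ijm}g^{mk}$,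 similarly $\Gamma_{ij}^{*k}$, and $\nabla_{\partial_i}\partial_j=\sum_k\Gamma_{ij}^k\partial_k$. Curvature: $R(X,Y)Z=\nabla_X\nabla_YZ-\nabla_Y\nabla_XZ-\nabla_{[X,Y]}Z$, with coefficients defined by $R(\partial_{\xi_i},\partial_{\xi_j})\partial_{\xi_k}=\sum_\ell R_{ijk}^\ell\,\partial_{\xi_\ell}$ (same for $R^*$ with $\nabla^*$). $\delta$ is the Kronecker delta; all indices range over $1,\dots,n-1$. *)

theory Defs
  imports "HOL-Analysis.Analysis"
begin

text \<open>
  The index set \<open>{1,\<dots>,n}\<close> is rendered by \<^typ>\<open>'m option\<close> for a finite type \<open>'m\<close> of cardinality
  \<open>n - 1\<close>: \<open>Some i\<close> stands for an index \<open>1 \<le> i \<le> n - 1\<close> and \<open>None\<close> for the index \<open>n\<close>. Every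
  \<open>n \<ge> 2\<close> arises this way, as types are nonempty. Coordinate systems of the simplex take values
  in \<^typ>\<open>real ^ 'm\<close>.
\<close>

definition open_simplex :: "(real ^ 'n) set" where
  "open_simplex = {p. (\<forall>i. p $ i > 0) \<and> (\<Sum>i\<in>UNIV. p $ i) = 1}"

definition tangent :: "(real ^ 'n) set" where
  "tangent = {v. (\<Sum>i\<in>UNIV. v $ i) = 0}"

text \<open>
  Directional derivative. For \<open>p \<in> open_simplex\<close> and \<open>v \<in> tangent\<close> it depends only on the values
  of \<open>f\<close> on the simplex, since \<open>p + t *\<^sub>R v\<close> stays in the simplex for small \<open>t\<close>.
\<close>

definition dderiv :: "(real ^ 'n \<Rightarrow> real) \<Rightarrow> real ^ 'n \<Rightarrow> real ^ 'n \<Rightarrow> real" where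
  "dderiv f p v = deriv (\<lambda>t. f (p + t *\<^sub>R v)) 0"

text \<open>
  \<open>C\<^sup>k\<close> functions on the simplex as an open subset of the affine hyperplane \<open>\<Sum>\<^sub>i p\<^sub>i = 1\<close>. The
  Frechet derivative within the simplex is determined only on \<open>tangent\<close>; the recursion is over
  those directions.
\<close>

primrec C_simplex :: "nat \<Rightarrow> (real ^ 'n \<Rightarrow> real) \<Rightarrow> bool" where
  "C_simplex 0 f \<longleftrightarrow> continuous_on open_simplex f"
| "C_simplex (Suc k) f \<longleftrightarrow> f differentiable_on open_simplex \<and>
     (\<forall>v\<in>tangent. C_simplex k (\<lambda>p. dderiv f p v))"

definition smooth_simplex :: "(real ^ 'n \<Rightarrow> real) \<Rightarrow> bool" where
  "smooth_simplex f \<longleftrightarrow> (\<forall>k. C_simplex k f)"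

definition hessian :: "(real ^ 'n \<Rightarrow> real) \<Rightarrow> real ^ 'n \<Rightarrow> real ^ 'n \<Rightarrow> real ^ 'n \<Rightarrow> real" where
  "hessian f p u v = dderiv (\<lambda>q. dderiv f q v) p u"

definition neg_def_hessian :: "(real ^ 'n \<Rightarrow> real) \<Rightarrow> real ^ 'n \<Rightarrow> bool" where
  "neg_def_hessian f p \<longleftrightarrow> (\<forall>v\<in>tangent. v \<noteq> 0 \<longrightarrow> hessian f p v v < 0)"

definition exp_concave :: "(real ^ 'n \<Rightarrow> real) \<Rightarrow> bool" where
  "exp_concave \<phi> \<longleftrightarrow> concave_on open_simplex (\<lambda>p. exp (\<phi> p))"

text \<open>\<open>L_div \<phi> q p\<close> is \<open>T(q | p)\<close>.\<close>

definition L_div :: "(real ^ 'n \<Rightarrow> real) \<Rightarrow> real ^ 'n \<Rightarrow> real ^ 'n \<Rightarrow> real" where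
  "L_div \<phi> q p = ln (1 + dderiv \<phi> p (q - p)) - (\<phi> q - \<phi> p)"

definition portfolio :: "(real ^ 'n \<Rightarrow> real) \<Rightarrow> real ^ 'n \<Rightarrow> real ^ 'n" where
  "portfolio \<phi> p = (\<chi> i. p $ i * (1 + dderiv \<phi> p (axis i 1 - p)))"

definition primal_coord :: "real ^ ('m option) \<Rightarrow> real ^ 'm" where
  "primal_coord p = (\<chi> i. ln (p $ Some i / p $ None))"

definition dual_coord :: "(real ^ ('m option) \<Rightarrow> real) \<Rightarrow> real ^ ('m option) \<Rightarrow> real ^ 'm" where
  "dual_coord \<phi> p =
     (\<chi> i. primal_coord p $ i - ln (portfolio \<phi> p $ Some i / portfolio \<phi> p $ None))"

text \<open>
  In what follows, a coordinate system is an injective map \<open>\<xi>\<close> from the simplex onto an open subset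
  of \<^typ>\<open>real ^ 'm\<close>, and \<open>D x x'\<close> is a divergence expressed in these coordinates; only the values
  at points of \<open>\<xi> ` open_simplex\<close> matter.
\<close>

definition div_in_coord ::
  "(real ^ ('m option) \<Rightarrow> real ^ ('m option) \<Rightarrow> real) \<Rightarrow> (real ^ ('m option) \<Rightarrow> real ^ 'm)
     \<Rightarrow> real ^ 'm \<Rightarrow> real ^ 'm \<Rightarrow> real" where
  "div_in_coord T \<xi> x x' =
     T (the_inv_into open_simplex \<xi> x) (the_inv_into open_simplex \<xi> x')"

definition pd :: "'m \<Rightarrow> (real ^ 'm \<Rightarrow> real) \<Rightarrow> real ^ 'm \<Rightarrow> real" where
  "pd i f x = dderiv f x (axis i 1)"

definition div_metric :: "(real ^ 'm \<Rightarrow> real ^ 'm \<Rightarrow> real) \<Rightarrow> real ^ 'm \<Rightarrow> real ^ 'm ^ 'm" where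
  "div_metric D x = (\<chi> i j. - pd i (\<lambda>a. pd j (\<lambda>b. D a b) x) x)"

definition primal_conn_low ::
  "(real ^ 'm \<Rightarrow> real ^ 'm \<Rightarrow> real) \<Rightarrow> real ^ 'm \<Rightarrow> 'm \<Rightarrow> 'm \<Rightarrow> 'm \<Rightarrow> real" where
  "primal_conn_low D x i j k = - pd i (pd j (\<lambda>a. pd k (\<lambda>b. D a b) x)) x"

definition dual_conn_low ::
  "(real ^ 'm \<Rightarrow> real ^ 'm \<Rightarrow> real) \<Rightarrow> real ^ 'm \<Rightarrow> 'm \<Rightarrow> 'm \<Rightarrow> 'm \<Rightarrow> real" where
  "dual_conn_low D x i j k = - pd k (\<lambda>a. pd i (pd j (\<lambda>b. D a b)) x) x"

definition raise_last ::
  "real ^ 'm ^ 'm \<Rightarrow> ('m \<Rightarrow> 'm \<Rightarrow> 'm \<Rightarrow> real) \<Rightarrow> 'm \<Rightarrow> 'm \<Rightarrow> 'm \<Rightarrow> real" where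
  "raise_last g G i j k = (\<Sum>m\<in>UNIV. G i j m * matrix_inv g $ m $ k)"

definition primal_conn ::
  "(real ^ 'm \<Rightarrow> real ^ 'm \<Rightarrow> real) \<Rightarrow> real ^ 'm \<Rightarrow> 'm \<Rightarrow> 'm \<Rightarrow> 'm \<Rightarrow> real" where
  "primal_conn D x = raise_last (div_metric D x) (primal_conn_low D x)"

definition dual_conn ::
  "(real ^ 'm \<Rightarrow> real ^ 'm \<Rightarrow> real) \<Rightarrow> real ^ 'm \<Rightarrow> 'm \<Rightarrow> 'm \<Rightarrow> 'm \<Rightarrow> real" where
  "dual_conn D x = raise_last (div_metric D x) (dual_conn_low D x)"

text \<open>
  Vector fields are given by their components in the coordinate frame. \<open>G x i j k\<close> is the
  coefficient of \<open>\<partial>\<^sub>k\<close> in \<open>\<nabla>\<close> of \<open>\<partial>\<^sub>j\<close> along \<open>\<partial>\<^sub>i\<close>, and \<open>cov_deriv\<close> is its extension to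
  all vector fields by linearity and the Leibniz rule.
\<close>

definition cov_deriv ::
  "(real ^ 'm \<Rightarrow> 'm \<Rightarrow> 'm \<Rightarrow> 'm \<Rightarrow> real) \<Rightarrow> (real ^ 'm \<Rightarrow> real ^ 'm) \<Rightarrow> (real ^ 'm \<Rightarrow> real ^ 'm)
     \<Rightarrow> real ^ 'm \<Rightarrow> real ^ 'm" where
  "cov_deriv G X Y x =
     (\<chi> k. (\<Sum>i\<in>UNIV. X x $ i * pd i (\<lambda>y. Y y $ k) x)
         + (\<Sum>i\<in>UNIV. \<Sum>j\<in>UNIV. X x $ i * Y x $ j * G x i j k))"

definition lie_bracket ::
  "(real ^ 'm \<Rightarrow> real ^ 'm) \<Rightarrow> (real ^ 'm \<Rightarrow> real ^ 'm) \<Rightarrow> real ^ 'm \<Rightarrow> real ^ 'm" where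
  "lie_bracket X Y x =
     (\<chi> k. \<Sum>i\<in>UNIV. X x $ i * pd i (\<lambda>y. Y y $ k) x - Y x $ i * pd i (\<lambda>y. X y $ k) x)"

definition curvature ::
  "(real ^ 'm \<Rightarrow> 'm \<Rightarrow> 'm \<Rightarrow> 'm \<Rightarrow> real) \<Rightarrow> (real ^ 'm \<Rightarrow> real ^ 'm) \<Rightarrow> (real ^ 'm \<Rightarrow> real ^ 'm)
     \<Rightarrow> (real ^ 'm \<Rightarrow> real ^ 'm) \<Rightarrow> real ^ 'm \<Rightarrow> real ^ 'm" where
  "curvature G X Y Z x =
     cov_deriv G X (cov_deriv G Y Z) x - cov_deriv G Y (cov_deriv G X Z) x
       - cov_deriv G (lie_bracket X Y) Z x"

definition frame :: "'m \<Rightarrow> real ^ 'm \<Rightarrow> real ^ 'm" where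
  "frame i x = axis i 1"

definition curv_coeff ::
  "(real ^ 'm \<Rightarrow> 'm \<Rightarrow> 'm \<Rightarrow> 'm \<Rightarrow> real) \<Rightarrow> real ^ 'm \<Rightarrow> 'm \<Rightarrow> 'm \<Rightarrow> 'm \<Rightarrow> 'm \<Rightarrow> real" where
  "curv_coeff G x i j k l = curvature G (frame i) (frame j) (frame k) x $ l"

definition kdelta :: "'m \<Rightarrow> 'm \<Rightarrow> real" where
  "kdelta i j = (if i = j then 1 else 0)"

end

theory Submission
  imports Defs
begin

text \<open>
  Put \<open>e = exp \<circ> \<phi>\<close>. Then \<open>T(q | p) = ln (W p q) - ln (e q)\<close>, where \<open>W p\<close> is the tangent plane of \<open>e\<close> at \<open>p\<close>.
  Since \<open>W p\<close> is affine, it is determined by its heights \<open>w\<^sub>k\<close> at the vertices of the simplex: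
  \<open>W p q = (\<Sum>k. q\<^sub>k w\<^sub>k)\<close>. The portfolio is \<open>\<pi>\<^sub>k = p\<^sub>k w\<^sub>k / e p\<close> and the dual coordinates of \<open>p\<close> are
  \<open>- ln (w\<^sub>i / w\<^sub>n)\<close>. Dividing \<open>W p q\<close> by \<open>q\<^sub>n w\<^sub>n\<close> yields (lemma \<open>divergence_softmax\<close>)

  \<open>T(q | p) = lse (primal q - dual p) + A q + B p\<close>   with   \<open>lse z = ln (1 + (\<Sum>i. exp z\<^sub>i))\<close>.

  Mixed derivatives do not see \<open>A\<close> and \<open>B\<close>, so that the whole geometry comes from \<^emph>\<open>lse\<close>. Its gradient
  is the softmax function, with value \<open>\<pi>\<close> on the diagonal, and its third derivative is its second derivative
  contracted with the symbols \<open>\<delta>\<^sub>i\<^sub>j \<delta>\<^sub>i\<^sub>k - \<pi>\<^sub>i \<delta>\<^sub>j\<^sub>k - \<pi>\<^sub>j \<delta>\<^sub>i\<^sub>k\<close>. In primal coordinates the Jacobian of the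
  dual coordinates is a factor of the metric and of the Christoffel symbols with lowered index, and it cancels when the
  index is raised. The symbols above are therefore the Christoffel symbols of the primal
  connection (\<open>primal_structure_lse_cost\<close>), and their negatives are those of the dual connection in dual coordinates
  (\<open>dual_structure_lse_cost\<close>).

  For the curvature only the derivative of \<open>\<pi>\<close> is missing. With \<open>H\<close> the Jacobian of softmax at \<open>primal - dual\<close>,
  it is \<open>H - g\<close> in primal and \<open>g - H\<close> in dual coordinates, where \<open>g\<close> is the metric. The
  terms with \<open>H\<close> cancel against the quadratic terms, as they do for the flat
  connection of \<^emph>\<open>lse\<close>, and the terms with \<open>g\<close> are the asserted formula (\<open>curv_coeff_lse_christoffel\<close>).

  It remains to see that the dual coordinates are a coordinate system and that the metric is symmetric and
  invertible. The metric is the Hessian of \<open>- e\<close> divided by \<open>e\<close>,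
  expressed in primal coordinates (\<open>dual_map_derivative\<close>), hence symmetric and definite. Strict
  concavity and positivity of \<open>e\<close> make all heights \<open>w\<^sub>k\<close> positive (\<open>tangent_plane_pos\<close>) and the dual coordinates injective
  (\<open>inj_dual_map\<close>); invariance of domain and the invertible Jacobian then turn them into a coordinate system
  with differentiable inverse.
\<close>

section \<open>Directional derivatives and the symmetry of the Hessian\<close>

lemma dderiv_eq:
  fixes f :: "real ^ 'n \<Rightarrow> real"
  assumes "(f has_derivative f') (at x)"
  shows "dderiv f x v = f' v"
proof -
  have "((\<lambda>t. x + t *\<^sub>R v) has_derivative (\<lambda>t. t *\<^sub>R v)) (at 0)"
    by (auto intro!: derivative_eq_intros)
  moreover have "(f has_derivative f') (at (x + 0 *\<^sub>R v))"
    using assms by simp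
  ultimately have "((\<lambda>t. f (x + t *\<^sub>R v)) has_derivative (\<lambda>t. f' (t *\<^sub>R v))) (at 0)"
    by (rule has_derivative_compose)
  moreover have "f' (t *\<^sub>R v) = f' v * t" for t
    using linear_scale[OF has_derivative_linear[OF assms]] by simp
  ultimately show ?thesis
    unfolding dderiv_def by (intro DERIV_imp_deriv) (simp add: has_field_derivative_def)
qed

lemma dderiv_cong_open:
  fixes f :: "real ^ 'n \<Rightarrow> real"
  assumes "open S" "x \<in> S" "\<And>y. y \<in> S \<Longrightarrow> f y = g y"
  shows "dderiv f x v = dderiv g x v"
proof -
  have "((\<lambda>t::real. x + t *\<^sub>R v) \<longlongrightarrow> x + 0 *\<^sub>R v) (nhds 0)"
    by (intro tendsto_intros) (simp add: filterlim_ident)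
  then have "eventually (\<lambda>t::real. x + t *\<^sub>R v \<in> S) (nhds 0)"
    by (rule topological_tendstoD) (use assms in auto)
  then have "eventually (\<lambda>t. f (x + t *\<^sub>R v) = g (x + t *\<^sub>R v)) (nhds 0)"
    by eventually_elim (rule assms)
  then show ?thesis
    unfolding dderiv_def by (rule deriv_cong_ev) simp
qed

lemmas pd_eq = dderiv_eq[where v = "axis i 1" for i, folded pd_def]
lemmas pd_cong_open = dderiv_cong_open[where v = "axis i 1" for i, folded pd_def]

lemma pd_const [simp]: "pd i (\<lambda>_. c) x = 0"
  by (simp add: pd_eq[OF has_derivative_const])

lemma has_derivative_vec_iff:
  fixes f :: "'a::real_normed_vector \<Rightarrow> real ^ 'n"
  shows "(f has_derivative f') (at x within S) \<longleftrightarrow>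
    (\<forall>i. ((\<lambda>y. f y $ i) has_derivative (\<lambda>v. f' v $ i)) (at x within S))"
  unfolding has_derivative_componentwise_within[of f] Basis_vec_def
  by (auto simp: cart_eq_inner_axis)

lemma has_derivative_nth:
  fixes f :: "'a::real_normed_vector \<Rightarrow> real ^ 'n"
  shows "(f has_derivative f') (at x within S) \<Longrightarrow>
    ((\<lambda>y. f y $ i) has_derivative (\<lambda>v. f' v $ i)) (at x within S)"
  by (simp add: has_derivative_vec_iff)

text \<open>The second difference \<open>\<Delta> s u v\<close> of \<open>e\<close> over a parallelogram with sides \<open>s *\<^sub>R u\<close> and
\<open>s *\<^sub>R v\<close> does not change when \<open>u\<close> and \<open>v\<close> are exchanged. The mean value theorem along \<open>u\<close> turns
it into \<open>s\<close> times an increment of the gradient in direction \<open>v\<close>, hence into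
\<open>s\<^sup>2 * (u \<bullet> (M *v v))\<close> up to an error of \<open>o(s\<^sup>2)\<close>; comparing the two expansions gives the
symmetry.\<close>

lemma hessian_symmetric:
  fixes e :: "real ^ 'n \<Rightarrow> real" and a :: "real ^ 'n \<Rightarrow> real ^ 'n" and M :: "real ^ 'n ^ 'n"
  assumes S: "open S" "x \<in> S"
    and e: "\<And>y. y \<in> S \<Longrightarrow> (e has_derivative (\<lambda>v. a y \<bullet> v)) (at y)"
    and a: "(a has_derivative (\<lambda>v. M *v v)) (at x)"
  shows "u \<bullet> (M *v v) = v \<bullet> (M *v u)"
proof -
  define \<Delta> where "\<Delta> s u v = e (x + s *\<^sub>R u + s *\<^sub>R v) - e (x + s *\<^sub>R u) - e (x + s *\<^sub>R v) + e x"
    for s :: real and u v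
  define C where "C u v = 2 * (norm u + norm v) * norm u" for u v :: "real ^ 'n"
  \<comment> \<open>The bound \<open>d\<close> keeps the whole parallelogram in \<open>S\<close> and within the range of the linear approximation of \<open>a\<close>.\<close>
  have est: "\<exists>d>0. \<forall>s. 0 < s \<and> s < d \<longrightarrow> \<bar>\<Delta> s u v - s\<^sup>2 * (u \<bullet> (M *v v))\<bar> \<le> s\<^sup>2 * (\<epsilon> * C u v)"
    if \<epsilon>: "\<epsilon> > 0" for \<epsilon> :: real and u v
  proof -
    obtain d1 where d1: "d1 > 0" "\<And>y. norm (y - x) < d1 \<Longrightarrow> y \<in> S"
      using S unfolding open_dist dist_norm by blast
    obtain d2 where d2: "d2 > 0"
      "\<And>y. norm (y - x) < d2 \<Longrightarrow> norm (a y - a x - M *v (y - x)) \<le> \<epsilon> * norm (y - x)"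
      using a[unfolded has_derivative_at_alt, THEN conjunct2, rule_format, OF \<epsilon>] by blast
    define d where "d = min d1 d2 / (norm u + norm v + 1)"
    have N: "norm u + norm v + 1 > 0"
      by (simp add: add_nonneg_pos)
    have "d > 0"
      using d1 d2 N by (simp add: d_def)
    moreover have "\<bar>\<Delta> s u v - s\<^sup>2 * (u \<bullet> (M *v v))\<bar> \<le> s\<^sup>2 * (\<epsilon> * C u v)" if s: "0 < s" "s < d" for s
    proof -
      have bd: "norm (r *\<^sub>R u + q *\<^sub>R v) \<le> s * (norm u + norm v)"
        "norm (r *\<^sub>R u + q *\<^sub>R v) < min d1 d2" if "0 \<le> r" "r \<le> s" "0 \<le> q" "q \<le> s" for r q
      proof -
        have "norm (r *\<^sub>R u + q *\<^sub>R v) \<le> r * norm u + q * norm v"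
          using norm_triangle_ineq[of "r *\<^sub>R u" "q *\<^sub>R v"] that by simp
        also have "\<dots> \<le> s * norm u + s * norm v"
          using that by (intro add_mono mult_right_mono) auto
        finally show 1: "norm (r *\<^sub>R u + q *\<^sub>R v) \<le> s * (norm u + norm v)"
          by (simp add: algebra_simps)
        also have "\<dots> < s * (norm u + norm v + 1)"
          using s by simp
        also have "\<dots> < d * (norm u + norm v + 1)"
          using s N by simp
        also have "\<dots> = min d1 d2"
          using N by (simp add: d_def)
        finally show "norm (r *\<^sub>R u + q *\<^sub>R v) < min d1 d2" .
      qed
      define g where "g r = e (x + r *\<^sub>R u + s *\<^sub>R v) - e (x + r *\<^sub>R u)" for r
      have g: "(g has_derivative (\<lambda>t. t * ((a (x + r *\<^sub>R u + s *\<^sub>R v) - a (x + r *\<^sub>R u)) \<bullet> u))) (at r)"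
        if r: "0 \<le> r" "r \<le> s" for r
      proof -
        have 1: "x + r *\<^sub>R u + s *\<^sub>R v \<in> S" "x + r *\<^sub>R u \<in> S"
          using d1(2)[of "x + r *\<^sub>R u + s *\<^sub>R v"] d1(2)[of "x + r *\<^sub>R u"] bd(2)[OF r, of s] bd(2)[OF r, of 0] s
          by (auto simp: add.assoc)
        have "((\<lambda>r. e (x + r *\<^sub>R u + s *\<^sub>R v)) has_derivative (\<lambda>t. a (x + r *\<^sub>R u + s *\<^sub>R v) \<bullet> (t *\<^sub>R u))) (at r)"
          by (rule has_derivative_compose[where f = "\<lambda>r. x + r *\<^sub>R u + s *\<^sub>R v", OF _ e[OF 1(1)]]) (auto intro!: derivative_eq_intros)
        moreover have "((\<lambda>r. e (x + r *\<^sub>R u)) has_derivative (\<lambda>t. a (x + r *\<^sub>R u) \<bullet> (t *\<^sub>R u))) (at r)"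
          by (rule has_derivative_compose[where f = "\<lambda>r. x + r *\<^sub>R u", OF _ e[OF 1(2)]]) (auto intro!: derivative_eq_intros)
        ultimately show ?thesis
          unfolding g_def
          by (auto intro!: derivative_eq_intros simp: algebra_simps inner_diff_left)
      qed
      obtain r where r: "0 < r" "r < s"
        "g s - g 0 = s * ((a (x + r *\<^sub>R u + s *\<^sub>R v) - a (x + r *\<^sub>R u)) \<bullet> u)"
        using mvt_simple[of 0 s g "\<lambda>r t. t * ((a (x + r *\<^sub>R u + s *\<^sub>R v) - a (x + r *\<^sub>R u)) \<bullet> u)"]
          s has_derivative_at_withinI[OF g] by auto
      define R1 where "R1 = a (x + (r *\<^sub>R u + s *\<^sub>R v)) - a x - M *v (r *\<^sub>R u + s *\<^sub>R v)"
      define R0 where "R0 = a (x + (r *\<^sub>R u + 0 *\<^sub>R v)) - a x - M *v (r *\<^sub>R u + 0 *\<^sub>R v)"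
      have small: "norm (a (x + w) - a x - M *v w) \<le> \<epsilon> * (s * (norm u + norm v))"
        if "norm w \<le> s * (norm u + norm v)" "norm w < min d1 d2" for w
      proof -
        have "norm (a (x + w) - a x - M *v w) \<le> \<epsilon> * norm w"
          using d2(2)[of "x + w"] that by simp
        also have "\<dots> \<le> \<epsilon> * (s * (norm u + norm v))"
          using that \<epsilon> by simp
        finally show ?thesis .
      qed
      have "norm R1 \<le> \<epsilon> * (s * (norm u + norm v))"
        unfolding R1_def using r s by (intro small bd) auto
      moreover have "norm R0 \<le> \<epsilon> * (s * (norm u + norm v))"
        unfolding R0_def using r s by (intro small bd) auto
      ultimately have "norm (R1 - R0) \<le> 2 * \<epsilon> * (s * (norm u + norm v))"
        using norm_triangle_ineq4[of R1 R0] by linarith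
      then have "\<bar>(R1 - R0) \<bullet> u\<bar> \<le> 2 * \<epsilon> * (s * (norm u + norm v)) * norm u"
        using Cauchy_Schwarz_ineq2[of "R1 - R0" u] mult_right_mono[OF _ norm_ge_zero[of u]]
        by (meson order_trans)
      moreover have "a (x + r *\<^sub>R u + s *\<^sub>R v) - a (x + r *\<^sub>R u) = R1 - R0 + s *\<^sub>R (M *v v)"
        by (simp add: R1_def R0_def matrix_vector_right_distrib matrix_vector_mult_scaleR add.assoc)
      then have "g s - g 0 = s * ((R1 - R0) \<bullet> u) + s\<^sup>2 * (u \<bullet> (M *v v))"
        unfolding r(3) by (simp add: inner_add_right distrib_left power2_eq_square inner_commute)
      moreover have "\<Delta> s u v = g s - g 0"
        by (simp add: \<Delta>_def g_def)
      ultimately have "\<bar>\<Delta> s u v - s\<^sup>2 * (u \<bullet> (M *v v))\<bar> \<le> s * (2 * \<epsilon> * (s * (norm u + norm v)) * norm u)"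
        using s by (simp add: abs_mult)
      then show ?thesis
        by (simp add: C_def power2_eq_square algebra_simps)
    qed
    ultimately show ?thesis
      by blast
  qed
  have bound: "\<bar>u \<bullet> (M *v v) - v \<bullet> (M *v u)\<bar> \<le> \<epsilon> * (C u v + C v u)" if \<epsilon>: "\<epsilon> > 0" for \<epsilon>
  proof -
    obtain d where d: "d > 0"
      "\<And>s. 0 < s \<and> s < d \<Longrightarrow> \<bar>\<Delta> s u v - s\<^sup>2 * (u \<bullet> (M *v v))\<bar> \<le> s\<^sup>2 * (\<epsilon> * C u v)"
      using est[OF \<epsilon>] by blast
    obtain d' where d': "d' > 0"
      "\<And>s. 0 < s \<and> s < d' \<Longrightarrow> \<bar>\<Delta> s v u - s\<^sup>2 * (v \<bullet> (M *v u))\<bar> \<le> s\<^sup>2 * (\<epsilon> * C v u)"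
      using est[OF \<epsilon>] by blast
    obtain s where s: "0 < s" "s < d" "s < d'"
      using d(1) d'(1) by (metis field_lbound_gt_zero)
    have "\<Delta> s u v = \<Delta> s v u"
      by (simp add: \<Delta>_def algebra_simps)
    then have "\<bar>s\<^sup>2 * (u \<bullet> (M *v v)) - s\<^sup>2 * (v \<bullet> (M *v u))\<bar> \<le> s\<^sup>2 * (\<epsilon> * C u v) + s\<^sup>2 * (\<epsilon> * C v u)"
      using d(2)[of s] d'(2)[of s] s by linarith
    then have "s\<^sup>2 * \<bar>u \<bullet> (M *v v) - v \<bullet> (M *v u)\<bar> \<le> s\<^sup>2 * (\<epsilon> * (C u v + C v u))"
      by (simp add: abs_mult distrib_left flip: right_diff_distrib)
    then show ?thesis
      using s by simp
  qed
  have "\<bar>u \<bullet> (M *v v) - v \<bullet> (M *v u)\<bar> \<le> 0 + \<epsilon>" if "\<epsilon> > 0" for \<epsilon>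
  proof -
    have C: "C u v + C v u \<ge> 0"
      by (simp add: C_def)
    have "\<bar>u \<bullet> (M *v v) - v \<bullet> (M *v u)\<bar> \<le> \<epsilon> / (C u v + C v u + 1) * (C u v + C v u)"
      using C that by (intro bound) simp
    also have "\<dots> \<le> \<epsilon>"
      using C that by (simp add: field_simps)
    finally show ?thesis
      by simp
  qed
  then have "\<bar>u \<bullet> (M *v v) - v \<bullet> (M *v u)\<bar> \<le> 0"
    by (rule field_le_epsilon)
  then show ?thesis
    by simp
qed

section \<open>The log-sum-exp function and its gradient\<close>

definition lse :: "real ^ 'm \<Rightarrow> real" where
  "lse z = ln (1 + (\<Sum>i\<in>UNIV. exp (z $ i)))"

definition softmax :: "real ^ 'm \<Rightarrow> real ^ 'm" where
  "softmax z = (\<chi> i. exp (z $ i) / (1 + (\<Sum>j\<in>UNIV. exp (z $ j))))"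

definition softmax_jac :: "real ^ 'm \<Rightarrow> real ^ 'm ^ 'm" where
  "softmax_jac z = (\<chi> i j. softmax z $ i * (kdelta i j - softmax z $ j))"

text \<open>The range of \<^const>\<open>softmax\<close>: the open simplex seen through its coordinates other than the last one,
which is an open subset of the vector space.\<close>

definition solid_simplex :: "(real ^ 'm) set" where
  "solid_simplex = {x. (\<forall>i. x $ i > 0) \<and> (\<Sum>i\<in>UNIV. x $ i) < 1}"

lemma sum_kdelta [simp]:
  fixes f :: "'m::finite \<Rightarrow> real"
  shows "(\<Sum>j\<in>UNIV. kdelta i j * f j) = f i" "(\<Sum>j\<in>UNIV. kdelta j i * f j) = f i"
    "(\<Sum>j\<in>UNIV. f j * kdelta i j) = f i" "(\<Sum>j\<in>UNIV. f j * kdelta j i) = f i"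
  by (simp_all add: kdelta_def if_distrib[of "\<lambda>c. c * _"] if_distrib[of "\<lambda>c. _ * c"] cong: if_cong)

lemma axis_nth_kdelta: "axis i (1::real) $ j = kdelta j i"
  by (simp add: axis_def kdelta_def)

lemma exp_sum_pos: "0 < 1 + (\<Sum>i\<in>UNIV. exp ((z :: real ^ 'm) $ i))"
  by (simp add: add_pos_nonneg sum_nonneg)

lemma sum_softmax: "1 - (\<Sum>i\<in>UNIV. softmax z $ i) = 1 / (1 + (\<Sum>i\<in>UNIV. exp (z $ i)))"
  using exp_sum_pos[of z] by (simp add: softmax_def flip: sum_divide_distrib) (simp add: field_simps)

lemma softmax_in_solid_simplex: "softmax z \<in> solid_simplex"
proof -
  have "1 - (\<Sum>i\<in>UNIV. softmax z $ i) > 0"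
    unfolding sum_softmax using exp_sum_pos[of z] by simp
  then show ?thesis
    using exp_sum_pos[of z] by (simp add: solid_simplex_def softmax_def)
qed

lemma softmax_log_odds:
  assumes "x \<in> solid_simplex"
  shows "softmax (\<chi> i. ln (x $ i / (1 - (\<Sum>j\<in>UNIV. x $ j)))) = x"
proof -
  define s where "s = 1 - (\<Sum>j\<in>UNIV. x $ j)"
  have s: "s > 0" and x: "x $ i > 0" for i
    using assms by (auto simp: s_def solid_simplex_def)
  have "1 + (\<Sum>j\<in>UNIV. x $ j / s) = 1 / s"
    using s by (simp add: s_def field_simps flip: sum_divide_distrib)
  then show ?thesis
    using s x by (simp add: softmax_def vec_eq_iff flip: s_def)
qed

lemma log_odds_softmax: "ln (softmax z $ i / (1 - (\<Sum>j\<in>UNIV. softmax z $ j))) = z $ i"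
  unfolding sum_softmax using exp_sum_pos[of z] by (simp add: softmax_def)

lemma softmax_jac_vec: "(softmax_jac z *v v) $ i = softmax z $ i * (v $ i - softmax z \<bullet> v)"
  by (simp add: softmax_jac_def matrix_vector_mult_def inner_vec_def algebra_simps sum_subtractf
      sum_distrib_left)

lemma has_derivative_lse: "(lse has_derivative (\<lambda>v. softmax z \<bullet> v)) (at z)"
  unfolding lse_def using exp_sum_pos[of z]
  by (auto intro!: derivative_eq_intros has_derivative_nth
      simp: softmax_def inner_vec_def sum_divide_distrib divide_inverse sum_distrib_left mult_ac)

lemma has_derivative_softmax: "(softmax has_derivative (\<lambda>v. softmax_jac z *v v)) (at z)"
proof -
  define s where "s = 1 + (\<Sum>i\<in>UNIV. exp (z $ i))"
  have s: "s > 0"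
    unfolding s_def by (rule exp_sum_pos)
  have 1: "(\<Sum>i\<in>UNIV. exp (z $ i) * v $ i) = s * (softmax z \<bullet> v)"
    "(\<Sum>i\<in>UNIV. v $ i * exp (z $ i)) = s * (softmax z \<bullet> v)" for v
    using s by (simp_all add: softmax_def inner_vec_def sum_distrib_left mult_ac flip: s_def)
  show ?thesis
    unfolding has_derivative_vec_iff
  proof
    fix i
    have "((\<lambda>y. exp (y $ i) / (1 + (\<Sum>j\<in>UNIV. exp (y $ j)))) has_derivative
       (\<lambda>v. exp (z $ i) / s * (v $ i - softmax z \<bullet> v))) (at z)"
      using s
      by (auto intro!: derivative_eq_intros has_derivative_nth simp: 1 fun_eq_iff simp flip: s_def)
        (simp add: field_simps)
    then show "((\<lambda>y. softmax y $ i) has_derivative (\<lambda>v. (softmax_jac z *v v) $ i)) (at z)"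
      unfolding softmax_jac_vec by (simp add: softmax_def s_def)
  qed
qed

lemma softmax_jac_sym: "softmax_jac z $ i $ j = softmax_jac z $ j $ i"
  by (simp add: softmax_jac_def kdelta_def)

lemma transpose_softmax_jac [simp]: "transpose (softmax_jac z) = softmax_jac z"
  by (simp add: transpose_def vec_eq_iff softmax_jac_sym)

lemma invertible_if_trivial_kernel:
  fixes A :: "real ^ 'n ^ 'n"
  assumes "\<And>v. A *v v = 0 \<Longrightarrow> v = 0"
  shows "invertible A"
  using assms by (auto simp: invertible_left_inverse matrix_left_invertible_ker)

text \<open>A kernel vector has all entries equal to its \<^const>\<open>softmax\<close> average; as the softmax weights have
total mass less than one, that average is zero.\<close>

lemma invertible_softmax_jac: "invertible (softmax_jac z)"
proof (rule invertible_if_trivial_kernel)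
  fix v :: "real ^ 'a"
  assume "softmax_jac z *v v = 0"
  moreover have pos: "softmax z $ i > 0" "(\<Sum>i\<in>UNIV. softmax z $ i) < 1" for i
    using softmax_in_solid_simplex[of z] by (auto simp: solid_simplex_def)
  ultimately have eq: "v $ i = softmax z \<bullet> v" for i
    by (metis softmax_jac_vec mult_eq_0_iff less_irrefl zero_index eq_iff_diff_eq_0)
  have "softmax z \<bullet> v = (\<Sum>i\<in>UNIV. softmax z $ i) * (softmax z \<bullet> v)"
    by (subst inner_vec_def) (simp add: eq flip: sum_distrib_right)
  then have "softmax z \<bullet> v = 0"
    using pos(2) by auto
  then show "v = 0"
    using eq by (simp add: vec_eq_iff)
qed

text \<open>The Christoffel symbols, with the last index raised, of the flat connection whose affine coordinates are the
entries of \<^const>\<open>softmax\<close>. Contracted with \<^const>\<open>softmax_jac\<close>, the second derivative of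
\<^const>\<open>lse\<close>, they give its third derivative.\<close>

definition lse_christoffel :: "real ^ 'm \<Rightarrow> 'm \<Rightarrow> 'm \<Rightarrow> 'm \<Rightarrow> real" where
  "lse_christoffel z i j k =
     kdelta i j * kdelta i k - softmax z $ i * kdelta j k - softmax z $ j * kdelta i k"

lemma has_derivative_softmax_jac:
  "((\<lambda>z. softmax_jac z $ i $ j) has_derivative
     (\<lambda>v. \<Sum>l\<in>UNIV. lse_christoffel z i j l * (softmax_jac z *v v) $ l)) (at z)"
proof -
  have 1: "(\<Sum>l\<in>UNIV. lse_christoffel z i j l * w $ l)
      = kdelta i j * w $ i - softmax z $ i * w $ j - softmax z $ j * w $ i" for w :: "real ^ 'a"
    by (simp add: lse_christoffel_def left_diff_distrib sum_subtractf mult.assoc flip: sum_distrib_left)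
  have "((\<lambda>z. softmax z $ i * (kdelta i j - softmax z $ j)) has_derivative
     (\<lambda>v. kdelta i j * (softmax_jac z *v v) $ i - softmax z $ i * (softmax_jac z *v v) $ j
       - softmax z $ j * (softmax_jac z *v v) $ i)) (at z)"
    by (auto intro!: derivative_eq_intros has_derivative_nth[OF has_derivative_softmax]
      simp: fun_eq_iff algebra_simps)
  then show ?thesis
    unfolding 1 by (simp add: softmax_jac_def)
qed

text \<open>Both sides are the third derivative of \<^const>\<open>lse\<close> in the directions \<open>i\<close>, \<open>j\<close>, \<open>m\<close>. It is
symmetric in all three indices, so the derivative direction on the left can take the place of the
lower index \<open>m\<close>.\<close>

lemma softmax_jac_third_symmetric:
  "(\<Sum>l\<in>UNIV. lse_christoffel z j m l * softmax_jac z $ l $ i) =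
   (\<Sum>l\<in>UNIV. lse_christoffel z i j l * softmax_jac z $ l $ m)"
  by (simp add: lse_christoffel_def left_diff_distrib sum_subtractf mult.assoc flip: sum_distrib_left)
    (simp add: softmax_jac_def kdelta_def algebra_simps)

section \<open>Curvature from Christoffel symbols of log-sum-exp type\<close>

lemma curv_coeff_eq:
  "curv_coeff \<Gamma> x i j k l = pd i (\<lambda>y. \<Gamma> y j k l) x - pd j (\<lambda>y. \<Gamma> y i k l) x
     + (\<Sum>m\<in>UNIV. \<Gamma> x j k m * \<Gamma> x i m l) - (\<Sum>m\<in>UNIV. \<Gamma> x i k m * \<Gamma> x j m l)"
proof -
  have [simp]: "(\<Sum>m\<in>UNIV. frame i x $ m * f m) = f i" for i :: 'a and f :: "'a \<Rightarrow> real" and x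
    by (simp add: frame_def axis_nth_kdelta)
  have [simp]: "pd i (\<lambda>y. frame j y $ k) x = 0" for i j k :: 'a and x
    by (simp add: frame_def)
  have [simp]: "lie_bracket (frame i) (frame j) = (\<lambda>_. 0)"
    by (simp add: lie_bracket_def fun_eq_iff vec_eq_iff)
  have [simp]: "cov_deriv \<Gamma> (\<lambda>_. 0) Z x = 0" for Z x
    by (simp add: cov_deriv_def vec_eq_iff)
  have [simp]: "cov_deriv \<Gamma> (frame i) (frame j) = (\<lambda>y. \<chi> k. \<Gamma> y i j k)" for i j
    by (simp add: cov_deriv_def fun_eq_iff vec_eq_iff mult.assoc flip: sum_distrib_left)
  show ?thesis
    by (simp add: curv_coeff_def curvature_def)
      (simp add: cov_deriv_def mult.assoc flip: sum_distrib_left)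
qed

text \<open>Both the derivative terms and the quadratic terms of the curvature carry the factor \<open>\<sigma>\<^sup>2 = 1\<close>. The quadratic terms
depend only on the softmax weights at \<open>z x\<close>, and the derivative terms depend linearly on
\<open>softmax_jac (z x) - g\<close>. For \<open>g = 0\<close> the result is the curvature of the flat connection
\<^const>\<open>lse_christoffel\<close>. Hence everything cancels except the part of the derivative terms that is linear in
\<open>g\<close>.\<close>

lemma curv_coeff_lse_christoffel:
  fixes z :: "real ^ 'm \<Rightarrow> real ^ 'm"
  assumes S: "open S" "x \<in> S"
    and \<Gamma>: "\<And>y i j k. y \<in> S \<Longrightarrow> \<Gamma> y i j k = \<sigma> * lse_christoffel (z y) i j k"
    and \<sigma>: "\<sigma>\<^sup>2 = 1"
    and z: "(z has_derivative (\<lambda>v. Z *v v)) (at x)"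
    and Z: "softmax_jac (z x) ** Z = \<sigma> *\<^sub>R (softmax_jac (z x) - g)"
    and g: "transpose g = g"
  shows "curv_coeff \<Gamma> x i j k l = kdelta l j * g $ i $ k - kdelta l i * g $ j $ k"
proof -
  define H where "H = softmax_jac (z x)"
  define p where "p = softmax (z x)"
  have g': "g $ i $ j = g $ j $ i" for i j
    by (metis g transpose_def vec_lambda_beta)
  have dp: "((\<lambda>y. softmax (z y) $ i) has_derivative (\<lambda>v. \<sigma> * ((H - g) *v v) $ i)) (at x)" for i
  proof -
    have "H *v (Z *v v) = \<sigma> *\<^sub>R ((H - g) *v v)" for v
      unfolding matrix_vector_mul_assoc H_def Z by (simp add: scaleR_matrix_vector_assoc)
    then show ?thesis
      using has_derivative_nth[OF has_derivative_compose[OF z has_derivative_softmax], of i]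
      by (simp add: H_def)
  qed
  have pd: "pd i (\<lambda>y. \<Gamma> y j k l) x =
      - (kdelta k l * (H $ j $ i - g $ j $ i) + kdelta j l * (H $ k $ i - g $ k $ i))" for i j k l
  proof -
    have "pd i (\<lambda>y. \<Gamma> y j k l) x = pd i (\<lambda>y. \<sigma> * lse_christoffel (z y) j k l) x"
      by (rule pd_cong_open[OF S]) (rule \<Gamma>)
    also have "((\<lambda>y. \<sigma> * lse_christoffel (z y) j k l) has_derivative
        (\<lambda>v. \<sigma> * (- (\<sigma> * ((H - g) *v v) $ j) * kdelta k l - (\<sigma> * ((H - g) *v v) $ k) * kdelta j l))) (at x)"
      unfolding lse_christoffel_def by (auto intro!: derivative_eq_intros dp)
    from pd_eq[OF this] have "pd i (\<lambda>y. \<sigma> * lse_christoffel (z y) j k l) x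
        = - \<sigma>\<^sup>2 * (((H - g) *v axis i 1) $ j * kdelta k l + ((H - g) *v axis i 1) $ k * kdelta j l)"
      by (simp add: algebra_simps power2_eq_square)
    also have "(H - g) *v axis i 1 = column i (H - g)"
      by (simp add: matrix_vector_mult_basis)
    finally show ?thesis
      using \<sigma> by (simp add: column_def)
  qed
  \<comment> \<open>Contracting the first factor over \<open>m\<close> collapses every sum, since each of its terms contains a Kronecker delta in \<open>m\<close>.\<close>
  have quad: "(\<Sum>m\<in>UNIV. \<Gamma> x j k m * \<Gamma> x i m l) =
     kdelta j k * (kdelta j i * kdelta j l - p $ i * kdelta j l - p $ j * kdelta i l)
     - p $ j * (kdelta k i * kdelta k l - p $ i * kdelta k l - p $ k * kdelta i l)
     - p $ k * (kdelta j i * kdelta j l - p $ i * kdelta j l - p $ j * kdelta i l)" for i j k l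
  proof -
    have "(\<Sum>m\<in>UNIV. \<Gamma> x j k m * \<Gamma> x i m l)
        = \<sigma>\<^sup>2 * (\<Sum>m\<in>UNIV. lse_christoffel (z x) j k m * lse_christoffel (z x) i m l)"
      using S(2) by (simp add: \<Gamma> sum_distrib_left power2_eq_square mult_ac)
    also have "\<dots> = (\<Sum>m\<in>UNIV. lse_christoffel (z x) j k m * lse_christoffel (z x) i m l)"
      using \<sigma> by simp
    also have "\<dots> = kdelta j k * lse_christoffel (z x) i j l
        - p $ j * lse_christoffel (z x) i k l - p $ k * lse_christoffel (z x) i j l"
      unfolding lse_christoffel_def[of _ j k] p_def
      by (simp add: left_diff_distrib sum_subtractf mult.assoc flip: sum_distrib_left)
    finally show ?thesis
      by (simp add: lse_christoffel_def p_def kdelta_def)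
  qed
  have H: "H $ a $ b = p $ a * (kdelta a b - p $ b)" for a b
    by (simp add: H_def p_def softmax_jac_def)
  show ?thesis
    unfolding curv_coeff_eq pd quad H using g'
    by (simp add: kdelta_def algebra_simps)
qed

section \<open>Divergences with a log-sum-exp cost\<close>

lemma raise_last_mult:
  assumes "invertible g" "\<And>i j m. G i j m = (\<Sum>l\<in>UNIV. c i j l * g $ l $ m)"
  shows "raise_last g G i j k = c i j k"
proof -
  have "g ** matrix_inv g = mat 1"
    using someI_ex[OF assms(1)[unfolded invertible_def]] by (simp add: matrix_inv_def)
  then have inv: "(\<Sum>m\<in>UNIV. g $ l $ m * matrix_inv g $ m $ k) = kdelta l k" for l
    by (auto simp: matrix_matrix_mult_def mat_def vec_eq_iff kdelta_def)
  have "raise_last g G i j k = (\<Sum>m\<in>UNIV. \<Sum>l\<in>UNIV. c i j l * (g $ l $ m * matrix_inv g $ m $ k))"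
    by (simp add: raise_last_def assms(2) sum_distrib_right mult.assoc)
  also have "\<dots> = (\<Sum>l\<in>UNIV. c i j l * (\<Sum>m\<in>UNIV. g $ l $ m * matrix_inv g $ m $ k))"
    by (subst sum.swap) (simp add: sum_distrib_left)
  finally show ?thesis
    by (simp add: inv)
qed

lemma inner_axis_matrix: "w \<bullet> (J *v axis k 1) = (\<Sum>m\<in>UNIV. w $ m * J $ m $ k)" for J :: "real ^ 'n ^ 'm"
  by (simp add: matrix_vector_mult_basis inner_vec_def column_def)

lemma matrix_vec_axis_nth: "(A *v axis k 1) $ i = A $ i $ k" for A :: "real ^ 'n ^ 'm"
  by (simp add: matrix_vector_mult_basis column_def)

text \<open>The terms \<open>A\<close> and \<open>B\<close> depend on one argument only and are killed by the mixed derivatives. What remains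
are derivatives of \<^const>\<open>lse\<close>, contracted with \<open>J\<close> in the index of the second argument. Raising this
index cancels \<open>J\<close>: the primal connection sees \<open>F\<close> only through the value \<open>F x\<close>.\<close>

lemma primal_structure_lse_cost:
  fixes F :: "real ^ 'm \<Rightarrow> real ^ 'm"
  assumes D: "\<And>a b. D a b = lse (a - F b) + A a + B b"
    and F: "(F has_derivative (\<lambda>v. J *v v)) (at x)"
    and B: "B differentiable (at x)"
    and inv: "invertible (softmax_jac (x - F x) ** J)"
  shows "div_metric D x = softmax_jac (x - F x) ** J"
    and "primal_conn D x i j k = lse_christoffel (x - F x) i j k"
proof -
  obtain B' where B': "(B has_derivative B') (at x)"
    using B by (auto simp: differentiable_def)
  have 1: "pd k (\<lambda>b. D a b) x = B' (axis k 1) - (\<Sum>m\<in>UNIV. softmax (a - F x) $ m * J $ m $ k)" for a k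
  proof -
    have "((\<lambda>b. a - F b) has_derivative (\<lambda>v. - (J *v v))) (at x)"
      by (auto intro!: derivative_eq_intros F)
    from has_derivative_compose[OF this has_derivative_lse]
    have "((\<lambda>b. D a b) has_derivative (\<lambda>v. B' v - softmax (a - F x) \<bullet> (J *v v))) (at x)"
      unfolding D by (auto intro!: derivative_eq_intros B' simp: inner_minus_right)
    from pd_eq[OF this] show ?thesis
      by (simp add: inner_axis_matrix)
  qed
  have shift: "((\<lambda>a. a - F x) has_derivative (\<lambda>v. v)) (at a)" for a
    by (auto intro!: derivative_eq_intros)
  have 2: "pd j (\<lambda>a. pd k (\<lambda>b. D a b) x) a = - (\<Sum>m\<in>UNIV. softmax_jac (a - F x) $ j $ m * J $ m $ k)" for a j k
  proof -
    have "((\<lambda>a. pd k (\<lambda>b. D a b) x) has_derivative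
        (\<lambda>v. - (\<Sum>m\<in>UNIV. (softmax_jac (a - F x) *v v) $ m * J $ m $ k))) (at a)"
      unfolding 1 by (auto intro!: derivative_eq_intros has_derivative_nth
          has_derivative_compose[OF shift has_derivative_softmax])
    from pd_eq[OF this] show ?thesis
      by (simp add: matrix_vec_axis_nth softmax_jac_sym[of _ j])
  qed
  show g: "div_metric D x = softmax_jac (x - F x) ** J"
    by (simp add: div_metric_def 2 matrix_matrix_mult_def vec_eq_iff)
  have low: "primal_conn_low D x i j k =
      (\<Sum>l\<in>UNIV. lse_christoffel (x - F x) i j l * div_metric D x $ l $ k)" for i j k
  proof -
    have "((\<lambda>a. pd j (\<lambda>a. pd k (\<lambda>b. D a b) x) a) has_derivative
        (\<lambda>v. - (\<Sum>m\<in>UNIV. (\<Sum>l\<in>UNIV. lse_christoffel (x - F x) j m l * (softmax_jac (x - F x) *v v) $ l)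
          * J $ m $ k))) (at x)"
      unfolding 2 by (auto intro!: derivative_eq_intros
          has_derivative_compose[OF shift has_derivative_softmax_jac])
    from pd_eq[OF this] have "primal_conn_low D x i j k =
        (\<Sum>m\<in>UNIV. (\<Sum>l\<in>UNIV. lse_christoffel (x - F x) j m l * softmax_jac (x - F x) $ l $ i) * J $ m $ k)"
      by (simp add: primal_conn_low_def matrix_vec_axis_nth)
    also have "\<dots> = (\<Sum>m\<in>UNIV. \<Sum>l\<in>UNIV. lse_christoffel (x - F x) i j l * (softmax_jac (x - F x) $ l $ m * J $ m $ k))"
      by (simp only: softmax_jac_third_symmetric[of "x - F x" j _ i]) (simp add: sum_distrib_right mult.assoc)
    also have "\<dots> = (\<Sum>l\<in>UNIV. lse_christoffel (x - F x) i j l * div_metric D x $ l $ k)"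
      by (subst sum.swap) (simp add: g matrix_matrix_mult_def sum_distrib_left)
    finally show ?thesis .
  qed
  show "primal_conn D x i j k = lse_christoffel (x - F x) i j k"
    unfolding primal_conn_def by (rule raise_last_mult) (use inv g low in auto)
qed

text \<open>Here the parametrisation is chosen such that the second argument enters the cost without
distortion. The derivative of \<open>B\<close> prescribed here is the one for which \<open>D a\<close> is
stationary at \<open>a\<close>; it makes \<open>B\<close> twice differentiable although \<open>G\<close> has only first
derivatives. The outer minus sign is that of the second argument in \<open>G a - b\<close>: the
first derivative in \<open>b\<close> changes sign, the second one does not.\<close>

lemma dual_structure_lse_cost:
  fixes G :: "real ^ 'm \<Rightarrow> real ^ 'm"
  assumes S: "open S" "x \<in> S"
    and D: "\<And>a b. a \<in> S \<Longrightarrow> b \<in> S \<Longrightarrow> D a b = lse (G a - b) + A a + B b"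
    and G: "(G has_derivative (\<lambda>v. K *v v)) (at x)"
    and B: "\<And>b. b \<in> S \<Longrightarrow> (B has_derivative (\<lambda>v. softmax (G b - b) \<bullet> v)) (at b)"
    and inv: "invertible (softmax_jac (G x - x) ** K)"
    and sym: "transpose (softmax_jac (G x - x) ** K) = softmax_jac (G x - x) ** K"
  shows "div_metric D x = softmax_jac (G x - x) ** K"
    and "dual_conn D x i j k = - lse_christoffel (G x - x) i j k"
proof -
  have shift: "((\<lambda>b. G a - b) has_derivative (\<lambda>v. - v)) (at b)" for a b
    by (auto intro!: derivative_eq_intros)
  have shift': "((\<lambda>a. G a - x) has_derivative (\<lambda>v. K *v v)) (at x)"
    by (auto intro!: derivative_eq_intros G)
  have diag: "((\<lambda>b. G b - b) has_derivative (\<lambda>v. K *v v - v)) (at x)"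
    by (auto intro!: derivative_eq_intros G)
  have 1: "pd j (\<lambda>b. D a b) b = softmax (G b - b) $ j - softmax (G a - b) $ j"
    if "a \<in> S" "b \<in> S" for a b j
  proof -
    have "pd j (\<lambda>b. D a b) b = pd j (\<lambda>b. lse (G a - b) + A a + B b) b"
      by (rule pd_cong_open[OF S(1)]) (use that D in auto)
    also have "((\<lambda>b. lse (G a - b) + A a + B b) has_derivative
        (\<lambda>v. softmax (G b - b) \<bullet> v - softmax (G a - b) \<bullet> v)) (at b)"
      using has_derivative_compose[OF shift[of a b] has_derivative_lse] B[OF that(2)]
      by (auto intro!: derivative_eq_intros simp: inner_minus_right)
    from pd_eq[OF this]
    have "pd j (\<lambda>b. lse (G a - b) + A a + B b) b = softmax (G b - b) $ j - softmax (G a - b) $ j"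
      by (simp add: inner_axis)
    finally show ?thesis .
  qed
  have g': "div_metric D x $ i $ j = (softmax_jac (G x - x) ** K) $ j $ i" for i j
  proof -
    have "pd i (\<lambda>a. pd j (\<lambda>b. D a b) x) x = pd i (\<lambda>a. softmax (G x - x) $ j - softmax (G a - x) $ j) x"
      by (rule pd_cong_open[OF S]) (use 1 S in auto)
    also have "((\<lambda>a. softmax (G x - x) $ j - softmax (G a - x) $ j) has_derivative
        (\<lambda>v. - (softmax_jac (G x - x) *v (K *v v)) $ j)) (at x)"
      by (auto intro!: derivative_eq_intros has_derivative_nth
          has_derivative_compose[OF shift' has_derivative_softmax])
    from pd_eq[OF this] have "pd i (\<lambda>a. softmax (G x - x) $ j - softmax (G a - x) $ j) x
        = - (softmax_jac (G x - x) ** K) $ j $ i"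
      by (simp add: matrix_vector_mul_assoc matrix_vec_axis_nth)
    finally show ?thesis
      by (simp add: div_metric_def)
  qed
  then show g: "div_metric D x = softmax_jac (G x - x) ** K"
    using sym by (simp add: vec_eq_iff transpose_def)
  have low: "dual_conn_low D x i j k =
      (\<Sum>l\<in>UNIV. - lse_christoffel (G x - x) i j l * div_metric D x $ l $ k)" for i j k
  proof -
    define c where "c = pd i (\<lambda>b. softmax (G b - b) $ j) x"
    have 2: "pd i (\<lambda>b. pd j (\<lambda>b. D a b) b) x = c + softmax_jac (G a - x) $ i $ j" if "a \<in> S" for a
    proof -
      have "pd i (\<lambda>b. pd j (\<lambda>b. D a b) b) x = pd i (\<lambda>b. softmax (G b - b) $ j - softmax (G a - b) $ j) x"
        by (rule pd_cong_open[OF S]) (use 1 that in auto)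
      also have "\<dots> = c + softmax_jac (G a - x) $ i $ j"
      proof -
        have d: "((\<lambda>b. softmax (G b - b) $ j) has_derivative
            (\<lambda>v. (softmax_jac (G x - x) *v (K *v v - v)) $ j)) (at x)"
          by (intro has_derivative_nth has_derivative_compose[OF diag has_derivative_softmax])
        moreover have "((\<lambda>b. softmax (G a - b) $ j) has_derivative
            (\<lambda>v. - (softmax_jac (G a - x) *v v) $ j)) (at x)"
          using has_derivative_nth[OF has_derivative_compose[OF shift[of a x] has_derivative_softmax], of j]
          by (simp add: linear_neg[OF matrix_vector_mul_linear])
        ultimately have "((\<lambda>b. softmax (G b - b) $ j - softmax (G a - b) $ j) has_derivative
            (\<lambda>v. (softmax_jac (G x - x) *v (K *v v - v)) $ j - - (softmax_jac (G a - x) *v v) $ j)) (at x)"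
          by (rule has_derivative_diff)
        from pd_eq[OF this] show ?thesis
          unfolding c_def pd_eq[OF d]
          by (simp add: matrix_vec_axis_nth softmax_jac_sym[of "G a - x" j i])
      qed
      finally show ?thesis .
    qed
    have "pd k (\<lambda>a. pd i (\<lambda>b. pd j (\<lambda>b. D a b) b) x) x = pd k (\<lambda>a. c + softmax_jac (G a - x) $ i $ j) x"
      by (rule pd_cong_open[OF S]) (rule 2)
    also have "((\<lambda>a. c + softmax_jac (G a - x) $ i $ j) has_derivative
        (\<lambda>v. \<Sum>l\<in>UNIV. lse_christoffel (G x - x) i j l * (softmax_jac (G x - x) *v (K *v v)) $ l)) (at x)"
      by (auto intro!: derivative_eq_intros has_derivative_compose[OF shift' has_derivative_softmax_jac])
    from pd_eq[OF this] have "pd k (\<lambda>a. c + softmax_jac (G a - x) $ i $ j) x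
        = (\<Sum>l\<in>UNIV. lse_christoffel (G x - x) i j l * div_metric D x $ l $ k)"
      by (simp add: g matrix_vector_mul_assoc matrix_vec_axis_nth)
    finally show ?thesis
      by (simp add: dual_conn_low_def sum_negf)
  qed
  show "dual_conn D x i j k = - lse_christoffel (G x - x) i j k"
    unfolding dual_conn_def by (rule raise_last_mult) (use inv g low in auto)
qed

section \<open>Strictly concave positive functions on the solid simplex\<close>

lemma open_solid_simplex: "open (solid_simplex :: (real ^ 'm) set)"
proof -
  have "solid_simplex = (\<Inter>i. {x :: real ^ 'm. 0 < x $ i}) \<inter> {x. (\<Sum>i\<in>UNIV. x $ i) < 1}"
    by (auto simp: solid_simplex_def)
  moreover have "open \<dots>"
    by (intro open_Int open_INT ballI open_Collect_less continuous_intros finite)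
  ultimately show ?thesis
    by simp
qed

lemma segment_to_closed_simplex:
  fixes x :: "real ^ 'm"
  assumes "x \<in> solid_simplex" "0 \<le> t" "t < 1"
    and z: "\<And>i. 0 \<le> z $ i" "(\<Sum>i\<in>UNIV. z $ i) \<le> 1"
  shows "x + t *\<^sub>R (z - x) \<in> solid_simplex"
proof -
  have x: "0 < x $ i" "(\<Sum>i\<in>UNIV. x $ i) < 1" for i
    using assms(1) by (auto simp: solid_simplex_def)
  have "(x + t *\<^sub>R (z - x)) $ i = (1 - t) * x $ i + t * z $ i" for i
    by (simp add: algebra_simps)
  moreover have "(1 - t) * x $ i + t * z $ i > 0" for i
    using x z assms by (simp add: add_pos_nonneg)
  moreover have "(1 - t) * (\<Sum>i\<in>UNIV. x $ i) + t * (\<Sum>i\<in>UNIV. z $ i) < 1"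
  proof -
    have "(1 - t) * (\<Sum>i\<in>UNIV. x $ i) < (1 - t) * 1"
      using x assms by (intro mult_strict_left_mono) auto
    moreover have "t * (\<Sum>i\<in>UNIV. z $ i) \<le> t * 1"
      using z assms by (intro mult_left_mono) auto
    ultimately show ?thesis
      using add_less_le_mono by fastforce
  qed
  ultimately show ?thesis
    by (simp add: solid_simplex_def sum.distrib flip: sum_distrib_left)
qed

text \<open>The function \<open>e\<close> stands for \<open>exp \<circ> \<phi>\<close> in the affine chart of the simplex that drops the last
coordinate; \<open>a\<close> is its gradient and \<open>M\<close> its Hessian matrix. Working with \<open>e\<close> instead of \<open>\<phi>\<close> makes
the L-divergence the logarithm of the ratio between the tangent plane of \<open>e\<close> and \<open>e\<close> itself.\<close>

locale strictly_concave_potential =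
  fixes e :: "real ^ 'm \<Rightarrow> real" and a :: "real ^ 'm \<Rightarrow> real ^ 'm" and M :: "real ^ 'm \<Rightarrow> real ^ 'm ^ 'm"
  assumes e_pos: "x \<in> solid_simplex \<Longrightarrow> e x > 0"
    and has_derivative_e: "x \<in> solid_simplex \<Longrightarrow> (e has_derivative (\<lambda>v. a x \<bullet> v)) (at x)"
    and has_derivative_a: "x \<in> solid_simplex \<Longrightarrow> (a has_derivative (\<lambda>v. M x *v v)) (at x)"
    and neg_def: "x \<in> solid_simplex \<Longrightarrow> v \<noteq> 0 \<Longrightarrow> v \<bullet> (M x *v v) < 0"
begin

definition tangent_plane :: "real ^ 'm \<Rightarrow> real ^ 'm \<Rightarrow> real" where
  "tangent_plane x y = e x + a x \<bullet> (y - x)"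

text \<open>An affine function is determined by its values at the vertices of the simplex, which are the origin and the
axis vectors. These heights of the tangent plane are the quotients \<open>\<pi>\<^sub>k / p\<^sub>k\<close> of the portfolio map, up to
the common factor \<open>e x\<close>.\<close>

definition origin_height :: "real ^ 'm \<Rightarrow> real" where
  "origin_height x = tangent_plane x 0"

definition axis_height :: "real ^ 'm \<Rightarrow> real ^ 'm" where
  "axis_height x = (\<chi> i. tangent_plane x (axis i 1))"

text \<open>The dual coordinates as a function of the primal ones: the factor \<open>p\<^sub>k\<close> in \<open>\<pi>\<^sub>k\<close> cancels against the primal
coordinate and only the ratio of two vertex heights is left.\<close>

definition dual_map :: "real ^ 'm \<Rightarrow> real ^ 'm" where
  "dual_map \<theta> = (\<chi> i. ln (origin_height (softmax \<theta>) / axis_height (softmax \<theta>) $ i))"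

lemma segment_in_solid_simplex:
  assumes "x \<in> solid_simplex" "y \<in> solid_simplex" "0 \<le> t" "t \<le> 1"
  shows "x + t *\<^sub>R (y - x) \<in> (solid_simplex :: (real ^ 'm) set)"
proof (cases "t = 1")
  case False
  then show ?thesis
    using assms by (intro segment_to_closed_simplex) (auto simp: solid_simplex_def less_imp_le)
qed (use assms in simp)

text \<open>Two applications of the mean value theorem along the segment from \<open>x\<close> to \<open>y\<close>, first to \<open>e\<close> and then to
its slope, express the gap through the Hessian at an intermediate point.\<close>

lemma below_tangent_plane:
  assumes x: "x \<in> solid_simplex" and y: "y \<in> solid_simplex" and "x \<noteq> y"
  shows "e y < tangent_plane x y"
proof -
  define d where "d = y - x"
  have d: "d \<noteq> 0"
    using assms by (simp add: d_def)
  have seg: "x + t *\<^sub>R d \<in> solid_simplex" if "0 \<le> t" "t \<le> 1" for t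
    using segment_in_solid_simplex[OF x y that] by (simp add: d_def)
  have line: "((\<lambda>t. x + t *\<^sub>R d) has_derivative (\<lambda>h. h *\<^sub>R d)) (at t)" for t
    by (auto intro!: derivative_eq_intros)
  have 1: "((\<lambda>t. e (x + t *\<^sub>R d)) has_derivative (\<lambda>h. a (x + t *\<^sub>R d) \<bullet> (h *\<^sub>R d))) (at t)"
    if "0 \<le> t" "t \<le> 1" for t
    by (rule has_derivative_compose[OF line has_derivative_e[OF seg[OF that]]])
  have 2: "((\<lambda>t. a (x + t *\<^sub>R d) \<bullet> d) has_derivative (\<lambda>h. (M (x + t *\<^sub>R d) *v (h *\<^sub>R d)) \<bullet> d)) (at t)"
    if "0 \<le> t" "t \<le> 1" for t
    by (rule has_derivative_inner_left[OF has_derivative_compose[OF line has_derivative_a[OF seg[OF that]]]])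
  obtain s where s: "0 < s" "s < 1" "e (x + 1 *\<^sub>R d) - e (x + 0 *\<^sub>R d) = a (x + s *\<^sub>R d) \<bullet> (1 *\<^sub>R d)"
    using mvt_simple[of 0 1 "\<lambda>t. e (x + t *\<^sub>R d)" "\<lambda>t h. a (x + t *\<^sub>R d) \<bullet> (h *\<^sub>R d)"]
      has_derivative_at_withinI[OF 1] by auto
  obtain r where r: "0 < r" "r < s"
      "a (x + s *\<^sub>R d) \<bullet> d - a (x + 0 *\<^sub>R d) \<bullet> d = (M (x + r *\<^sub>R d) *v ((s - 0) *\<^sub>R d)) \<bullet> d"
    using mvt_simple[of 0 s "\<lambda>t. a (x + t *\<^sub>R d) \<bullet> d" "\<lambda>t h. (M (x + t *\<^sub>R d) *v (h *\<^sub>R d)) \<bullet> d"]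
      has_derivative_at_withinI[OF 2] s by auto
  have "(M (x + r *\<^sub>R d) *v ((s - 0) *\<^sub>R d)) \<bullet> d = s * (d \<bullet> (M (x + r *\<^sub>R d) *v d))"
    by (simp add: matrix_vector_mult_scaleR inner_commute)
  also have "\<dots> < 0"
    using s r d neg_def[OF seg, of r d] by (intro mult_pos_neg) auto
  finally show ?thesis
    using s(3) r(3) by (simp add: tangent_plane_def d_def)
qed

lemma tangent_plane_self [simp]: "tangent_plane x x = e x"
  by (simp add: tangent_plane_def)

text \<open>The point \<open>z\<close> may lie on the boundary, where \<open>e\<close> is not controlled, so strictness has to come from
the interior. The tangent plane at the midpoint \<open>m\<close> is nonnegative at \<open>z\<close>, being a limit of values above
\<open>e > 0\<close>, and hence its value at \<open>x\<close> is at most twice its value \<open>e m\<close> at the midpoint. Therefore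
\<open>e x \<le> 2 * e m\<close>, and \<open>e m\<close> lies strictly below the tangent plane at \<open>x\<close>, whose value at \<open>m\<close> is the average of
\<open>e x\<close> and its value at \<open>z\<close>.\<close>

lemma tangent_plane_pos:
  assumes x: "x \<in> solid_simplex" and z: "\<And>i. 0 \<le> z $ i" "(\<Sum>i\<in>UNIV. z $ i) \<le> 1" and "z \<noteq> x"
  shows "tangent_plane x z > 0"
proof -
  define m where "m = x + (1/2) *\<^sub>R (z - x)"
  have m: "m \<in> solid_simplex"
    unfolding m_def by (rule segment_to_closed_simplex) (use x z in auto)
  have "m \<noteq> x"
    using \<open>z \<noteq> x\<close> by (simp add: m_def)
  have "tangent_plane m (m + t *\<^sub>R (z - m)) \<ge> 0" if "0 \<le> t" "t < 1" for t
  proof -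
    have t: "m + t *\<^sub>R (z - m) \<in> solid_simplex"
      by (rule segment_to_closed_simplex) (use m z that in auto)
    then show ?thesis
      using below_tangent_plane[OF m t] e_pos[OF t] e_pos[OF m]
      by (cases "m = m + t *\<^sub>R (z - m)") (use less_imp_le in fastforce)+
  qed
  moreover have "((\<lambda>t. tangent_plane m (m + t *\<^sub>R (z - m))) \<longlongrightarrow> tangent_plane m (m + 1 *\<^sub>R (z - m))) (at_left 1)"
    unfolding tangent_plane_def by (intro tendsto_intros)
  moreover have "eventually (\<lambda>t::real. 0 \<le> t \<and> t < 1) (at_left 1)"
    by (rule eventually_mono[OF eventually_at_left_real[of 0 "1::real"]]) auto
  ultimately have "tangent_plane m (m + 1 *\<^sub>R (z - m)) \<ge> 0"
    by (intro tendsto_lowerbound[of _ _ "at_left 1"]) (auto elim: eventually_mono)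
  then have mz: "tangent_plane m z \<ge> 0"
    by simp
  have mid: "2 * tangent_plane y m = tangent_plane y x + tangent_plane y z" for y
  proof -
    have "2 *\<^sub>R (m - y) = (x - y) + (z - y)"
      by (simp add: m_def algebra_simps scaleR_2)
    then have "2 * (a y \<bullet> (m - y)) = a y \<bullet> (x - y) + a y \<bullet> (z - y)"
      by (metis inner_add_right inner_scaleR_right)
    then show ?thesis
      by (simp add: tangent_plane_def)
  qed
  have "e x \<le> tangent_plane m x"
    using below_tangent_plane[OF m x] \<open>m \<noteq> x\<close> by simp
  moreover have "e m < tangent_plane x m"
    using below_tangent_plane[OF x m] \<open>m \<noteq> x\<close> by simp
  ultimately show ?thesis
    using mid[of m] mid[of x] mz by simp
qed

lemma heights_pos:
  assumes "x \<in> solid_simplex"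
  shows "origin_height x > 0" "axis_height x $ i > 0"
proof -
  have x: "0 < x $ i" "(\<Sum>j\<in>UNIV. x $ j) < 1"
    using assms by (auto simp: solid_simplex_def)
  have ax: "(\<Sum>j\<in>UNIV. axis i (1::real) $ j) = 1"
    using sum_kdelta(2)[of i "\<lambda>_. 1"] by (simp add: axis_nth_kdelta)
  have "0 \<noteq> x" "axis i 1 \<noteq> x"
    using x ax by auto
  then show "origin_height x > 0" "axis_height x $ i > 0"
    unfolding origin_height_def axis_height_def
    using tangent_plane_pos[OF assms, of 0] tangent_plane_pos[OF assms, of "axis i 1"]
      ax
    by (auto simp: axis_nth_kdelta kdelta_def)
qed

lemma axis_height_eq: "axis_height x $ i = origin_height x + a x $ i"
  by (simp add: axis_height_def origin_height_def tangent_plane_def inner_diff_right inner_axis)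

lemma tangent_plane_eq:
  "tangent_plane x y = (1 - (\<Sum>i\<in>UNIV. y $ i)) * origin_height x + (\<Sum>i\<in>UNIV. y $ i * axis_height x $ i)"
  unfolding axis_height_eq
  by (simp add: distrib_left sum.distrib left_diff_distrib flip: sum_distrib_right)
    (simp add: origin_height_def tangent_plane_def inner_diff_right inner_vec_def[of "a x" y] mult.commute)

text \<open>Equal dual coordinates mean that the tangent planes at \<open>x\<close> and \<open>y\<close> are proportional as functions. If \<open>x\<close> and \<open>y\<close>
differ, then strict concavity, used at both points, forces the factor to be at once less than one
and greater than one.\<close>

lemma inj_dual_map: "inj dual_map"
proof (rule injI)
  fix \<theta> \<theta>'
  assume eq: "dual_map \<theta> = dual_map \<theta>'"
  define x y where "x = softmax \<theta>" and "y = softmax \<theta>'"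
  have x: "x \<in> solid_simplex" and y: "y \<in> solid_simplex"
    by (simp_all add: x_def y_def softmax_in_solid_simplex)
  note pos = heights_pos[OF x] heights_pos[OF y]
  define c where "c = origin_height y / origin_height x"
  have c: "c > 0"
    using pos by (simp add: c_def)
  have ratio: "origin_height x / axis_height x $ i = origin_height y / axis_height y $ i" for i
    using eq pos by (simp add: dual_map_def vec_eq_iff x_def y_def)
  have "axis_height y $ i = c * axis_height x $ i" for i
    using ratio[of i] pos(1,3) pos(2,4)[of i] by (simp add: c_def field_simps)
  moreover have "origin_height y = c * origin_height x"
    using pos by (simp add: c_def)
  ultimately have scale: "tangent_plane y q = c * tangent_plane x q" for q
    by (simp add: tangent_plane_eq distrib_left sum_distrib_left mult_ac)
  have "x = y"
  proof (rule ccontr)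
    assume "x \<noteq> y"
    then have "e y < tangent_plane x y" "e x < tangent_plane y x"
      using below_tangent_plane x y by auto
    then have "e y < e y / c" "e x < c * e x"
      using scale[of y] scale[of x] c by (auto simp: field_simps)
    then show False
      using e_pos[OF x] e_pos[OF y] c by (simp add: field_simps)
  qed
  then show "\<theta> = \<theta>'"
    using log_odds_softmax by (metis (no_types, lifting) vec_eq_iff x_def y_def)
qed

text \<open>The entries of the portfolio map other than the last one.\<close>

definition weight :: "real ^ 'm \<Rightarrow> real ^ 'm" where
  "weight x = (\<chi> i. x $ i * axis_height x $ i / e x)"

lemma weight_sum:
  assumes "x \<in> solid_simplex"
  shows "1 - (\<Sum>i\<in>UNIV. weight x $ i) = (1 - (\<Sum>i\<in>UNIV. x $ i)) * origin_height x / e x"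
  using tangent_plane_eq[of x x] e_pos[OF assms]
  by (simp add: weight_def field_simps flip: sum_divide_distrib)

lemma weight_in_solid_simplex:
  assumes "x \<in> solid_simplex"
  shows "weight x \<in> solid_simplex"
proof -
  have "1 - (\<Sum>i\<in>UNIV. weight x $ i) > 0"
    using assms heights_pos[OF assms] e_pos[OF assms] by (simp add: weight_sum) (simp add: solid_simplex_def)
  then show ?thesis
    using assms heights_pos[OF assms] e_pos[OF assms] by (simp add: solid_simplex_def weight_def)
qed

lemma softmax_minus_dual_map: "softmax (\<theta> - dual_map \<theta>) = weight (softmax \<theta>)"
proof -
  define x where "x = softmax \<theta>"
  have x: "x \<in> solid_simplex"
    by (simp add: x_def softmax_in_solid_simplex)
  then have x': "x $ i > 0" "1 - (\<Sum>j\<in>UNIV. x $ j) > 0" for i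
    by (auto simp: solid_simplex_def)
  note pos = heights_pos[OF x] e_pos[OF x]
  have "(\<theta> - dual_map \<theta>) $ i = ln (weight x $ i / (1 - (\<Sum>j\<in>UNIV. weight x $ j)))" for i
  proof -
    have "weight x $ i / (1 - (\<Sum>j\<in>UNIV. weight x $ j))
        = (x $ i / (1 - (\<Sum>j\<in>UNIV. x $ j))) / (origin_height x / axis_height x $ i)"
      unfolding weight_sum[OF x] using pos by (simp add: weight_def)
    then have "ln (weight x $ i / (1 - (\<Sum>j\<in>UNIV. weight x $ j)))
        = ln (x $ i / (1 - (\<Sum>j\<in>UNIV. x $ j))) - ln (origin_height x / axis_height x $ i)"
      by (simp only:) (rule ln_divide_pos; use pos x' in auto)
    then show ?thesis
      by (simp add: dual_map_def x_def log_odds_softmax)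
  qed
  then have "\<theta> - dual_map \<theta> = (\<chi> i. ln (weight x $ i / (1 - (\<Sum>j\<in>UNIV. weight x $ j))))"
    by (simp add: vec_eq_iff)
  then show ?thesis
    using softmax_log_odds[OF weight_in_solid_simplex[OF x]] by (simp add: x_def)
qed

definition divergence :: "real ^ 'm \<Rightarrow> real ^ 'm \<Rightarrow> real" where
  "divergence y x = ln (tangent_plane x y) - ln (e y)"

text \<open>The tangent plane at \<open>x\<close> is a combination of its vertex heights with the entries of \<open>y\<close> as weights. Dividing by the
last of its terms gives a sum of the form \<open>1 + (\<Sum>i. exp _)\<close>, in which the exponents
are differences of a primal coordinate of \<open>y\<close> and a dual coordinate of \<open>x\<close>.\<close>

lemma divergence_softmax:
  "divergence (softmax \<theta>) (softmax \<theta>') = lse (\<theta> - dual_map \<theta>')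
     + (ln (1 - (\<Sum>i\<in>UNIV. softmax \<theta> $ i)) - ln (e (softmax \<theta>)))
     + ln (origin_height (softmax \<theta>'))"
proof -
  define x y where "x = softmax \<theta>'" and "y = softmax \<theta>"
  have x: "x \<in> solid_simplex" and y: "y \<in> solid_simplex"
    by (simp_all add: x_def y_def softmax_in_solid_simplex)
  define s where "s = 1 - (\<Sum>i\<in>UNIV. y $ i)"
  have s: "s > 0" and y': "y $ i > 0" for i
    using y by (auto simp: s_def solid_simplex_def)
  note pos = heights_pos[OF x]
  have "exp ((\<theta> - dual_map \<theta>') $ i) = y $ i * axis_height x $ i / (s * origin_height x)" for i
  proof -
    have "\<theta> $ i = ln (y $ i / s)"
      by (simp add: y_def s_def log_odds_softmax)
    then show ?thesis
      using s y' pos by (simp add: dual_map_def exp_diff flip: x_def)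
  qed
  then have eq: "1 + (\<Sum>i\<in>UNIV. exp ((\<theta> - dual_map \<theta>') $ i)) = tangent_plane x y / (s * origin_height x)"
    using s pos by (simp add: tangent_plane_eq add_divide_distrib flip: s_def sum_divide_distrib)
  have "tangent_plane x y > 0"
    using exp_sum_pos[of "\<theta> - dual_map \<theta>'"] mult_pos_pos[OF s pos(1)]
    unfolding eq by (simp only: zero_less_divide_iff) auto
  then have "lse (\<theta> - dual_map \<theta>') = ln (tangent_plane x y) - ln s - ln (origin_height x)"
    unfolding lse_def eq using s pos by (simp add: ln_div ln_mult)
  then show ?thesis
    by (simp add: divergence_def x_def y_def s_def)
qed

text \<open>The Hessian of \<open>e\<close> pulled back to primal coordinates, and divided by \<open>- e\<close>. It turns out to be the metric of the
divergence; in this form symmetry and definiteness are visible.\<close>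

definition metric :: "real ^ 'm \<Rightarrow> real ^ 'm ^ 'm" where
  "metric \<theta> = (- 1 / e (softmax \<theta>)) *\<^sub>R (softmax_jac \<theta> ** M (softmax \<theta>) ** softmax_jac \<theta>)"

lemma metric_vec:
  "metric \<theta> *v u = (- 1 / e (softmax \<theta>)) *\<^sub>R (softmax_jac \<theta> *v (M (softmax \<theta>) *v (softmax_jac \<theta> *v u)))"
  by (simp only: metric_def matrix_vector_mul_assoc matrix_mul_assoc flip: scaleR_matrix_vector_assoc)

lemma transpose_metric: "transpose (metric \<theta>) = metric \<theta>"
proof -
  have sym: "u \<bullet> (M (softmax \<theta>) *v v) = v \<bullet> (M (softmax \<theta>) *v u)" for u v
    by (rule hessian_symmetric[OF open_solid_simplex softmax_in_solid_simplex])
      (auto intro: has_derivative_e has_derivative_a softmax_in_solid_simplex)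
  have "M (softmax \<theta>) $ j $ i = M (softmax \<theta>) $ i $ j" for i j
    using sym[of "axis j 1" "axis i 1"] by (simp add: inner_axis' matrix_vec_axis_nth)
  then have "transpose (M (softmax \<theta>)) = M (softmax \<theta>)"
    by (simp add: vec_eq_iff transpose_def)
  then show ?thesis
    by (simp only: metric_def matrix_transpose_mul matrix_mul_assoc transpose_scalar transpose_softmax_jac)
qed

lemma invertible_metric: "invertible (metric \<theta>)"
proof (rule invertible_if_trivial_kernel)
  fix u
  have ker: "v = 0" if "softmax_jac \<theta> *v v = 0" for v
    using invertible_softmax_jac[of \<theta>] that by (auto simp: invertible_left_inverse matrix_left_invertible_ker)
  have x: "softmax \<theta> \<in> solid_simplex"
    by (rule softmax_in_solid_simplex)
  assume "metric \<theta> *v u = 0"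
  then have "softmax_jac \<theta> *v (M (softmax \<theta>) *v (softmax_jac \<theta> *v u)) = 0"
    using e_pos[OF x] by (simp add: metric_vec)
  then have "M (softmax \<theta>) *v (softmax_jac \<theta> *v u) = 0"
    by (rule ker)
  then have "softmax_jac \<theta> *v u = 0"
    using neg_def[OF x, of "softmax_jac \<theta> *v u"] by auto
  then show "u = 0"
    by (rule ker)
qed

text \<open>When \<open>x\<close> moves with velocity \<open>v\<close>, the height of the tangent plane above \<open>y\<close> changes at the rate
\<open>(y - x) \<bullet> (M x *v v)\<close>, which is zero at \<open>y = x\<close>. In terms of the logarithmic derivatives of the vertex
heights, this says that their mean with respect to the portfolio weights vanishes. Hence the
portfolio average of the derivative of the dual coordinates is the logarithmic derivative of the height at
the origin; this is the last claim, which expresses that the divergence is stationary on the diagonal.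
Multiplication by \<^const>\<open>softmax_jac\<close> centres a vector at this average and multiplies it by
the weights, which isolates the Hessian of \<open>e\<close>.\<close>

lemma dual_map_derivative:
  obtains J where "(dual_map has_derivative (\<lambda>u. J *v u)) (at \<theta>)"
    and "softmax_jac (\<theta> - dual_map \<theta>) ** J = metric \<theta>"
    and "((\<lambda>\<theta>. ln (origin_height (softmax \<theta>))) has_derivative
      (\<lambda>u. softmax (\<theta> - dual_map \<theta>) \<bullet> (J *v u))) (at \<theta>)"
proof -
  define x where "x = softmax \<theta>"
  have x: "x \<in> solid_simplex"
    by (simp add: x_def softmax_in_solid_simplex)
  define m where "m u = M x *v (softmax_jac \<theta> *v u)" for u
  define w0 where "w0 = origin_height x"
  define w where "w i = axis_height x $ i" for i
  have pos: "w0 > 0" "w i > 0" "e x > 0" for i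
    using heights_pos[OF x] e_pos[OF x] by (simp_all add: w0_def w_def)
  note sm = has_derivative_softmax[of \<theta>]
  have "(origin_height has_derivative (\<lambda>v. - (x \<bullet> (M x *v v)))) (at x)"
    unfolding origin_height_def tangent_plane_def
    by (auto intro!: derivative_eq_intros has_derivative_e[OF x] has_derivative_a[OF x]
        simp: inner_minus_right inner_commute)
  from has_derivative_compose[OF sm this[unfolded x_def]]
  have d0: "((\<lambda>\<theta>. origin_height (softmax \<theta>)) has_derivative (\<lambda>u. - (x \<bullet> m u))) (at \<theta>)"
    by (simp add: m_def x_def)
  have da: "((\<lambda>\<theta>. a (softmax \<theta>) $ i) has_derivative (\<lambda>u. m u $ i)) (at \<theta>)" for i
    using has_derivative_nth[OF has_derivative_compose[OF sm has_derivative_a[OF x, unfolded x_def]]]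
    by (simp add: m_def x_def)
  have ln0: "((\<lambda>\<theta>. ln (origin_height (softmax \<theta>))) has_derivative (\<lambda>u. - (x \<bullet> m u) / w0)) (at \<theta>)"
    using pos(1) by (auto intro!: derivative_eq_intros d0 simp: w0_def x_def divide_inverse)
  define f' where "f' u = (\<chi> i. - (x \<bullet> m u) / w0 - (m u $ i - x \<bullet> m u) / w i)" for u
  have dual_map_eq: "dual_map \<theta> $ i = ln (origin_height (softmax \<theta>)) - ln (axis_height (softmax \<theta>) $ i)"
    for i \<theta>
    using heights_pos[OF softmax_in_solid_simplex, of \<theta>] by (simp add: dual_map_def ln_divide_pos)
  have df: "(dual_map has_derivative f') (at \<theta>)"
    unfolding has_derivative_vec_iff
  proof
    fix i
    have "((\<lambda>\<theta>. axis_height (softmax \<theta>) $ i) has_derivative (\<lambda>u. m u $ i - x \<bullet> m u)) (at \<theta>)"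
      unfolding axis_height_eq by (auto intro!: derivative_eq_intros d0 da)
    then have "((\<lambda>\<theta>. ln (axis_height (softmax \<theta>) $ i)) has_derivative
        (\<lambda>u. (m u $ i - x \<bullet> m u) / w i)) (at \<theta>)"
      using pos(2)[of i] by (auto intro!: derivative_eq_intros simp: w_def x_def divide_inverse)
    from has_derivative_diff[OF ln0 this]
    show "((\<lambda>\<theta>. dual_map \<theta> $ i) has_derivative (\<lambda>u. f' u $ i)) (at \<theta>)"
      unfolding dual_map_eq by (simp add: f'_def)
  qed
  define J where "J = matrix f'"
  have J: "J *v u = f' u" for u
    using fun_cong[OF matrix_vector_mul(2)[OF has_derivative_linear[OF df]]] by (simp add: J_def)
  have sw: "softmax (\<theta> - dual_map \<theta>) = weight x"
    by (simp add: softmax_minus_dual_map x_def)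
  have wi: "weight x $ i * f' u $ i = - (x \<bullet> m u) / w0 * weight x $ i - (x $ i * m u $ i - x $ i * (x \<bullet> m u)) / e x"
    for i u
    using pos(1,3) pos(2)[of i] by (simp add: f'_def weight_def field_simps flip: w_def)
  \<comment> \<open>Uses that the last portfolio weight is \<open>t * w0 / e x\<close> and that \<open>x\<close> has total mass \<open>1 - t\<close>.\<close>
  have avg: "weight x \<bullet> f' u = - (x \<bullet> m u) / w0" for u
  proof -
    define t where "t = 1 - (\<Sum>i\<in>UNIV. x $ i)"
    have "weight x \<bullet> f' u = - (x \<bullet> m u) / w0 * (\<Sum>i\<in>UNIV. weight x $ i)
        - ((\<Sum>i\<in>UNIV. x $ i * m u $ i) - (\<Sum>i\<in>UNIV. x $ i) * (x \<bullet> m u)) / e x"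
      unfolding inner_vec_def[of "weight x"] inner_real_def wi
      by (simp only: sum_subtractf sum_distrib_left sum_distrib_right flip: sum_divide_distrib)
    also have "(\<Sum>i\<in>UNIV. x $ i * m u $ i) = x \<bullet> m u"
      by (simp add: inner_vec_def)
    also have "(\<Sum>i\<in>UNIV. x $ i) = 1 - t"
      by (simp add: t_def)
    also have "(\<Sum>i\<in>UNIV. weight x $ i) = 1 - t * w0 / e x"
      using weight_sum[OF x] by (simp add: t_def w0_def)
    finally show ?thesis
      using pos by (simp add: field_simps)
  qed
  have "softmax_jac (\<theta> - dual_map \<theta>) *v (J *v u) = metric \<theta> *v u" for u
  proof -
    have "weight x $ i * (f' u $ i - weight x \<bullet> f' u) = - 1 / e x * (x $ i * (m u $ i - x \<bullet> m u))" for i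
      unfolding avg using pos(1,3) pos(2)[of i] by (simp add: f'_def weight_def field_simps flip: w_def)
    then show ?thesis
      unfolding vec_eq_iff metric_vec J softmax_jac_vec sw vector_scaleR_component
      by (simp add: m_def x_def softmax_jac_vec)
  qed
  then have "softmax_jac (\<theta> - dual_map \<theta>) ** J = metric \<theta>"
    by (simp add: matrix_eq matrix_vector_mul_assoc)
  moreover have "(dual_map has_derivative (\<lambda>u. J *v u)) (at \<theta>)"
    unfolding J by (rule df)
  moreover have "((\<lambda>\<theta>. ln (origin_height (softmax \<theta>))) has_derivative
      (\<lambda>u. softmax (\<theta> - dual_map \<theta>) \<bullet> (J *v u))) (at \<theta>)"
    unfolding J sw avg by (rule ln0)
  ultimately show thesis
    by (intro that)
qed

text \<open>The primal Christoffel symbols are those of \<^const>\<open>lse\<close> at \<open>\<theta> - dual_map \<theta>\<close>. If the dual coordinates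
were constant, this would be a translate of a flat connection; the curvature comes from their
derivative, which \<^const>\<open>softmax_jac\<close> turns into the metric.\<close>

theorem primal_curvature:
  assumes D: "\<And>a b. D a b = divergence (softmax a) (softmax b)"
  shows "invertible (div_metric D \<theta>)"
    and "curv_coeff (primal_conn D) \<theta> i j k l =
      kdelta l j * div_metric D \<theta> $ i $ k - kdelta l i * div_metric D \<theta> $ j $ k"
proof -
  have primal: "div_metric D \<theta> = metric \<theta>"
    "primal_conn D \<theta> i j k = lse_christoffel (\<theta> - dual_map \<theta>) i j k" for \<theta> i j k
  proof -
    obtain J where J: "(dual_map has_derivative (\<lambda>u. J *v u)) (at \<theta>)"
      "softmax_jac (\<theta> - dual_map \<theta>) ** J = metric \<theta>"
      "((\<lambda>\<theta>. ln (origin_height (softmax \<theta>))) has_derivative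
        (\<lambda>u. softmax (\<theta> - dual_map \<theta>) \<bullet> (J *v u))) (at \<theta>)"
      by (rule dual_map_derivative)
    have "D a b = lse (a - dual_map b) + (ln (1 - (\<Sum>i\<in>UNIV. softmax a $ i)) - ln (e (softmax a)))
        + ln (origin_height (softmax b))" for a b
      unfolding D by (rule divergence_softmax)
    note cost = primal_structure_lse_cost[OF this J(1), unfolded J(2),
        OF differentiableI[OF J(3)] invertible_metric]
    show "div_metric D \<theta> = metric \<theta>" "primal_conn D \<theta> i j k = lse_christoffel (\<theta> - dual_map \<theta>) i j k"
      by (rule cost)+
  qed
  show "invertible (div_metric D \<theta>)"
    unfolding primal by (rule invertible_metric)
  obtain J where J: "(dual_map has_derivative (\<lambda>u. J *v u)) (at \<theta>)"
    "softmax_jac (\<theta> - dual_map \<theta>) ** J = metric \<theta>"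
    by (rule dual_map_derivative)
  show "curv_coeff (primal_conn D) \<theta> i j k l =
      kdelta l j * div_metric D \<theta> $ i $ k - kdelta l i * div_metric D \<theta> $ j $ k"
    unfolding primal
  proof (rule curv_coeff_lse_christoffel[where S = UNIV and \<sigma> = 1 and Z = "mat 1 - J" and z = "\<lambda>y. y - dual_map y"])
    show "((\<lambda>y. y - dual_map y) has_derivative (\<lambda>v. (mat 1 - J) *v v)) (at \<theta>)"
      by (auto intro!: derivative_eq_intros J(1) simp: matrix_vector_mult_diff_rdistrib)
    show "softmax_jac (\<theta> - dual_map \<theta>) ** (mat 1 - J) = 1 *\<^sub>R (softmax_jac (\<theta> - dual_map \<theta>) - metric \<theta>)"
      by (simp add: matrix_eq matrix_vector_mult_diff_rdistrib matrix_vector_mult_diff_distrib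
          flip: J(2) matrix_vector_mul_assoc)
  qed (simp_all add: primal transpose_metric)
qed

text \<open>The dual map is injective with invertible derivative, so its range is open and its inverse \<open>G\<close> is
differentiable, with derivative \<open>K\<close>. The point \<open>\<theta> - dual_map \<theta>\<close> reads \<open>G y - y\<close> in dual coordinates: now the
identity is the subtracted part, and the Christoffel symbols as well as the derivative of the
softmax weights change sign in comparison with the primal connection.\<close>

theorem dual_curvature:
  assumes D: "\<And>a b. D (dual_map a) (dual_map b) = divergence (softmax a) (softmax b)"
  shows "invertible (div_metric D (dual_map \<theta>))"
    and "curv_coeff (dual_conn D) (dual_map \<theta>) i j k l =
      kdelta l j * div_metric D (dual_map \<theta>) $ i $ k - kdelta l i * div_metric D (dual_map \<theta>) $ j $ k"
proof -
  define S where "S = range dual_map"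
  define G where "G = inv dual_map"
  have G [simp]: "G (dual_map \<theta>) = \<theta>" for \<theta>
    by (simp add: G_def inj_dual_map)
  have cont: "continuous_on UNIV dual_map"
    unfolding continuous_on_eq_continuous_within
    by (metis dual_map_derivative has_derivative_continuous)
  have S: "open S"
    unfolding S_def by (rule invariance_of_domain[OF cont open_UNIV inj_dual_map])
  have ex: "\<exists>K. (G has_derivative (\<lambda>v. K *v v)) (at (dual_map \<theta>)) \<and>
      invertible (softmax_jac (\<theta> - dual_map \<theta>) ** K) \<and>
      transpose (softmax_jac (\<theta> - dual_map \<theta>) ** K) = softmax_jac (\<theta> - dual_map \<theta>) ** K \<and>
      ((\<lambda>y. ln (origin_height (softmax (G y)))) has_derivative (\<lambda>v. softmax (\<theta> - dual_map \<theta>) \<bullet> v))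
        (at (dual_map \<theta>))" for \<theta>
  proof -
    define P where "P = softmax_jac (\<theta> - dual_map \<theta>)"
    obtain J where J: "(dual_map has_derivative (\<lambda>u. J *v u)) (at \<theta>)"
      "P ** J = metric \<theta>"
      "((\<lambda>\<theta>. ln (origin_height (softmax \<theta>))) has_derivative
        (\<lambda>u. softmax (\<theta> - dual_map \<theta>) \<bullet> (J *v u))) (at \<theta>)"
      unfolding P_def by (rule dual_map_derivative)
    obtain Q where Q: "Q ** metric \<theta> = mat 1"
      using invertible_metric[of \<theta>] by (auto simp: invertible_left_inverse)
    define K where "K = Q ** P"
    have KJ: "K ** J = mat 1"
      using Q by (simp add: K_def J(2) flip: matrix_mul_assoc)
    then have JK: "J ** K = mat 1"
      by (simp add: matrix_left_right_inverse)
    have dG: "(G has_derivative (\<lambda>v. K *v v)) (at (dual_map \<theta>))"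
      by (rule has_derivative_inverse_strong[OF open_UNIV UNIV_I cont _ J(1)])
        (simp_all add: fun_eq_iff matrix_vector_mul_assoc JK)
    moreover have "invertible (P ** K)"
      unfolding P_def using KJ JK by (intro invertible_mult invertible_softmax_jac) (auto simp: invertible_def)
    \<comment> \<open>As \<open>P\<close> and \<open>P ** J\<close> are symmetric, \<open>transpose J ** P = P ** J\<close>; conjugation by the inverse \<open>K\<close> of \<open>J\<close> gives the claim.\<close>
    moreover have "transpose (P ** K) = P ** K"
    proof -
      have P: "transpose P = P"
        by (simp add: P_def)
      have "transpose J ** P = P ** J"
        using transpose_metric[of \<theta>] P by (simp add: matrix_transpose_mul flip: J(2))
      then have "transpose K ** (transpose J ** P) ** K = transpose K ** (P ** J) ** K"
        by simp
      moreover have "transpose K ** (transpose J ** P) ** K = P ** K"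
        unfolding matrix_mul_assoc by (simp add: JK flip: matrix_transpose_mul)
      moreover have "transpose K ** (P ** J) ** K = transpose K ** P"
        by (simp add: JK flip: matrix_mul_assoc)
      ultimately show ?thesis
        by (simp add: matrix_transpose_mul P)
    qed
    moreover have "((\<lambda>y. ln (origin_height (softmax (G y)))) has_derivative
        (\<lambda>v. softmax (\<theta> - dual_map \<theta>) \<bullet> v)) (at (dual_map \<theta>))"
      using has_derivative_compose[OF dG, of "\<lambda>\<theta>. ln (origin_height (softmax \<theta>))", unfolded G, OF J(3)]
      by (simp add: matrix_vector_mul_assoc JK)
    ultimately show ?thesis
      unfolding P_def by blast
  qed
  have D': "D a b = lse (G a - b) + (ln (1 - (\<Sum>i\<in>UNIV. softmax (G a) $ i)) - ln (e (softmax (G a))))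
        + ln (origin_height (softmax (G b)))" if "a \<in> S" "b \<in> S" for a b
    using that unfolding S_def by (auto simp: D divergence_softmax)
  have B: "((\<lambda>y. ln (origin_height (softmax (G y)))) has_derivative (\<lambda>v. softmax (G b - b) \<bullet> v)) (at b)"
    if b: "b \<in> S" for b
  proof -
    obtain \<theta> where "b = dual_map \<theta>"
      using b by (auto simp: S_def)
    then show ?thesis
      using ex[of \<theta>] by auto
  qed
  have conn: "dual_conn D y i j k = - 1 * lse_christoffel (G y - y) i j k" if y: "y \<in> S" for y i j k
  proof -
    obtain \<theta> where \<theta>: "y = dual_map \<theta>"
      using y by (auto simp: S_def)
    obtain K where K: "(G has_derivative (\<lambda>v. K *v v)) (at y)"
      "invertible (softmax_jac (G y - y) ** K)"
      "transpose (softmax_jac (G y - y) ** K) = softmax_jac (G y - y) ** K"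
      using ex[of \<theta>] unfolding \<theta> by auto
    show ?thesis
      using dual_structure_lse_cost(2)[OF S y D' K(1) B K(2,3)] by simp
  qed
  define x where "x = dual_map \<theta>"
  have x: "x \<in> S"
    by (simp add: x_def S_def)
  obtain K where K: "(G has_derivative (\<lambda>v. K *v v)) (at x)"
    "invertible (softmax_jac (G x - x) ** K)"
    "transpose (softmax_jac (G x - x) ** K) = softmax_jac (G x - x) ** K"
    using ex[of \<theta>] unfolding x_def by auto
  have g: "div_metric D x = softmax_jac (G x - x) ** K"
    by (rule dual_structure_lse_cost(1)[OF S x D' K(1) B K(2,3)])
  have "curv_coeff (dual_conn D) x i j k l =
      kdelta l j * div_metric D x $ i $ k - kdelta l i * div_metric D x $ j $ k"
  proof (rule curv_coeff_lse_christoffel[OF S x conn])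
    show "((\<lambda>y. G y - y) has_derivative (\<lambda>v. (K - mat 1) *v v)) (at x)"
      by (auto intro!: derivative_eq_intros K(1) simp: matrix_vector_mult_diff_rdistrib)
    show "softmax_jac (G x - x) ** (K - mat 1) = (- 1) *\<^sub>R (softmax_jac (G x - x) - div_metric D x)"
      by (simp add: g matrix_eq matrix_vector_mult_diff_rdistrib matrix_vector_mult_diff_distrib
          flip: matrix_vector_mul_assoc)
  qed (simp_all add: g K)
  then show "curv_coeff (dual_conn D) (dual_map \<theta>) i j k l =
      kdelta l j * div_metric D (dual_map \<theta>) $ i $ k - kdelta l i * div_metric D (dual_map \<theta>) $ j $ k"
    by (simp add: x_def)
  show "invertible (div_metric D (dual_map \<theta>))"
    using K(2) by (simp add: g flip: x_def)
qed

end

text \<open>An entry \<open>g $ i $ k \<noteq> 0\<close> is itself a coefficient: take \<open>l = j\<close> for an index \<open>j\<close> other than \<open>i\<close>.\<close>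

lemma constant_curvature_form_nonzero:
  fixes g :: "real ^ 'm ^ 'm"
  assumes R: "\<And>i j k l. R i j k l = kdelta l j * g $ i $ k - kdelta l i * g $ j $ k"
    and "invertible g" and "CARD('m option) \<ge> 3"
  shows "\<exists>i j k l. R i j k l \<noteq> (0 :: real)"
proof -
  have "g \<noteq> 0"
  proof
    assume "g = 0"
    then have "v = 0" for v :: "real ^ 'm"
      using \<open>invertible g\<close> unfolding invertible_left_inverse matrix_left_invertible_ker by simp
    from this[of 1] show False
      by simp
  qed
  then obtain i k where ik: "g $ i $ k \<noteq> 0"
    by (auto simp: vec_eq_iff)
  have "CARD('m) \<noteq> 1"
    using assms(3) by (simp add: card_UNIV_option)
  then obtain j where "j \<noteq> i"
    by (metis (full_types) UNIV_eq_I card_1_singleton_iff One_nat_def singleton_iff)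
  then have "R i j k j = g $ i $ k"
    by (simp add: R kdelta_def)
  then show ?thesis
    using ik by metis
qed

section \<open>The affine chart of the open simplex\<close>

definition chart :: "real ^ 'm \<Rightarrow> real ^ ('m option)" where
  "chart x = (\<chi> k. case k of None \<Rightarrow> 1 - (\<Sum>i\<in>UNIV. x $ i) | Some i \<Rightarrow> x $ i)"

definition chart_dir :: "real ^ 'm \<Rightarrow> real ^ ('m option)" where
  "chart_dir v = (\<chi> k. case k of None \<Rightarrow> - (\<Sum>i\<in>UNIV. v $ i) | Some i \<Rightarrow> v $ i)"

lemma chart_nth [simp]: "chart x $ Some i = x $ i" "chart x $ None = 1 - (\<Sum>i\<in>UNIV. x $ i)"
  by (simp_all add: chart_def)

lemma chart_dir_nth [simp]: "chart_dir v $ Some i = v $ i" "chart_dir v $ None = - (\<Sum>i\<in>UNIV. v $ i)"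
  by (simp_all add: chart_dir_def)

lemma vec_option_eq_iff:
  fixes p q :: "real ^ ('m::finite option)"
  shows "p = q \<longleftrightarrow> p $ None = q $ None \<and> (\<forall>i. p $ Some i = q $ Some i)"
  by (auto simp: vec_eq_iff) (metis option.exhaust)

lemma sum_option_UNIV:
  fixes f :: "'m::finite option \<Rightarrow> real"
  shows "(\<Sum>k\<in>UNIV. f k) = f None + (\<Sum>i\<in>UNIV. f (Some i))"
  by (simp add: UNIV_option_conv sum.reindex)

lemma chart_dir_tangent: "chart_dir v \<in> tangent"
  by (simp add: tangent_def sum_option_UNIV)

lemma chart_in_open_simplex:
  assumes "x \<in> solid_simplex"
  shows "chart x \<in> open_simplex"
proof -
  have "chart x $ k > 0" for k
    using assms by (cases k) (auto simp: solid_simplex_def)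
  then show ?thesis
    by (simp add: open_simplex_def sum_option_UNIV)
qed

lemma open_simplex_eq_chart:
  assumes "p \<in> open_simplex"
  obtains x where "x \<in> solid_simplex" "p = chart x"
proof
  have "p $ None > 0" "p $ None + (\<Sum>i\<in>UNIV. p $ Some i) = 1" "p $ Some i > 0" for i
    using assms by (auto simp: open_simplex_def sum_option_UNIV)
  then show "(\<chi> i. p $ Some i) \<in> solid_simplex" "p = chart (\<chi> i. p $ Some i)"
    by (auto simp: solid_simplex_def vec_option_eq_iff)
qed

lemma chart_line: "chart x + t *\<^sub>R chart_dir v = chart (x + t *\<^sub>R v)"
  by (simp add: vec_option_eq_iff sum.distrib flip: sum_distrib_left)

lemma chart_diff: "chart y - chart x = chart_dir (y - x)"
  by (simp add: vec_option_eq_iff sum_subtractf)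

lemma dderiv_chart: "dderiv f (chart x) (chart_dir v) = dderiv (\<lambda>y. f (chart y)) x v"
  by (simp add: dderiv_def chart_line)

lemma has_derivative_chart:
  fixes x :: "real ^ 'm"
  shows "(chart has_derivative chart_dir) (at x)"
proof -
  have "linear (chart_dir :: real ^ 'm \<Rightarrow> _)"
    by (rule linearI) (simp_all add: vec_option_eq_iff sum.distrib sum_distrib_left)
  then have "((\<lambda>y. chart_dir y + chart 0) has_derivative chart_dir) (at x)"
    by (intro has_derivative_add_const linear_imp_has_derivative)
  moreover have "chart_dir y + chart 0 = chart y" for y :: "real ^ 'm"
    by (simp add: vec_option_eq_iff)
  ultimately show ?thesis
    by simp
qed

text \<open>The derivative of \<open>f\<close> within the simplex is determined on tangent vectors only; composition with the chart
gives an ordinary derivative on an open subset of the vector space, with the directional derivatives as its values.\<close>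

lemma has_derivative_in_chart:
  assumes f: "f differentiable_on open_simplex" and x: "x \<in> solid_simplex"
  shows "((\<lambda>y. f (chart y)) has_derivative (\<lambda>v. dderiv f (chart x) (chart_dir v))) (at x)"
proof -
  obtain L where L: "(f has_derivative L) (at (chart x) within open_simplex)"
    using f chart_in_open_simplex[OF x] unfolding differentiable_on_def differentiable_def by blast
  have "((\<lambda>y. f (chart y)) has_derivative (\<lambda>v. L (chart_dir v))) (at x within solid_simplex)"
    by (rule has_derivative_in_compose[OF has_derivative_at_withinI[OF has_derivative_chart]])
      (rule has_derivative_subset[OF L], auto simp: chart_in_open_simplex)
  then have "((\<lambda>y. f (chart y)) has_derivative (\<lambda>v. L (chart_dir v))) (at x)"
    unfolding at_within_open[OF x open_solid_simplex] .
  moreover from dderiv_eq[OF this] have "L (chart_dir v) = dderiv f (chart x) (chart_dir v)" for v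
    by (simp add: dderiv_chart)
  ultimately show ?thesis
    by simp
qed

section \<open>Coordinate systems on the open simplex\<close>

definition simplex_point :: "real ^ 'm \<Rightarrow> real ^ ('m option)" where
  "simplex_point \<theta> = chart (softmax \<theta>)"

lemma simplex_point_in: "simplex_point \<theta> \<in> open_simplex"
  by (simp add: simplex_point_def chart_in_open_simplex softmax_in_solid_simplex)

lemma open_simplex_eq_simplex_point:
  assumes "p \<in> open_simplex"
  obtains \<theta> where "p = simplex_point \<theta>"
proof -
  obtain x where x: "x \<in> solid_simplex" "p = chart x"
    using assms by (rule open_simplex_eq_chart)
  show thesis
    by (rule that) (simp add: simplex_point_def x(2), rule arg_cong[OF softmax_log_odds[OF x(1), symmetric]])
qed

lemma primal_coord_simplex_point: "primal_coord (simplex_point \<theta>) = \<theta>"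
  by (simp add: primal_coord_def simplex_point_def log_odds_softmax vec_eq_iff)

text \<open>Here \<open>c\<close> is a coordinate system and \<open>h\<close> its expression in primal coordinates.\<close>

lemma coordinate_representation:
  assumes c: "\<And>\<theta>. c (simplex_point \<theta>) = h \<theta>" and "inj h"
  shows "c ` open_simplex = range h"
    and "the_inv_into open_simplex c (h \<theta>) = simplex_point \<theta>"
proof -
  show "c ` open_simplex = range h"
  proof (intro equalityI subsetI)
    fix y
    assume "y \<in> c ` open_simplex"
    then obtain p where p: "p \<in> open_simplex" "y = c p"
      by blast
    obtain \<theta> where "p = simplex_point \<theta>"
      using p(1) by (rule open_simplex_eq_simplex_point)
    with p(2) show "y \<in> range h"
      by (simp add: c)
  next
    fix y
    assume "y \<in> range h"
    then obtain \<theta> where "y = h \<theta>"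
      by blast
    then have "y = c (simplex_point \<theta>)"
      by (simp add: c)
    then show "y \<in> c ` open_simplex"
      using simplex_point_in by blast
  qed
  have "inj_on c open_simplex"
  proof (rule inj_onI)
    fix p q
    assume "p \<in> open_simplex" "q \<in> open_simplex" and eq: "c p = c q"
    then obtain \<theta> \<theta>' where "p = simplex_point \<theta>" "q = simplex_point \<theta>'"
      by (metis open_simplex_eq_simplex_point)
    with eq show "p = q"
      using \<open>inj h\<close> by (simp add: c inj_eq)
  qed
  then show "the_inv_into open_simplex c (h \<theta>) = simplex_point \<theta>"
    by (rule the_inv_into_f_eq) (simp_all add: c simplex_point_in)
qed

section \<open>The curvature of the geometry of an L-divergence\<close>

theorem theorem4p9:
  fixes \<phi> :: "real ^ ('m::finite option) \<Rightarrow> real"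
    and D\<theta> D\<phi> :: "real ^ 'm \<Rightarrow> real ^ 'm \<Rightarrow> real"
  defines "D\<theta> \<equiv> div_in_coord (L_div \<phi>) primal_coord"
    and "D\<phi> \<equiv> div_in_coord (L_div \<phi>) (dual_coord \<phi>)"
  assumes "smooth_simplex \<phi>"
    and "exp_concave \<phi>"
    and "\<And>p. p \<in> open_simplex \<Longrightarrow> neg_def_hessian (\<lambda>q. exp (\<phi> q)) p"
  shows "(\<forall>x \<in> primal_coord ` open_simplex. \<forall>i j k l.
            curv_coeff (primal_conn D\<theta>) x i j k l =
              kdelta l j * div_metric D\<theta> x $ i $ k - kdelta l i * div_metric D\<theta> x $ j $ k)
       \<and> (\<forall>x \<in> dual_coord \<phi> ` open_simplex. \<forall>i j k l.
            curv_coeff (dual_conn D\<phi>) x i j k l =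
              kdelta l j * div_metric D\<phi> x $ i $ k - kdelta l i * div_metric D\<phi> x $ j $ k)
       \<and> (CARD('m option) \<ge> 3 \<longrightarrow> (\<forall>p \<in> open_simplex.
            (\<exists>i j k l. curv_coeff (primal_conn D\<theta>) (primal_coord p) i j k l \<noteq> 0)
          \<and> (\<exists>i j k l. curv_coeff (dual_conn D\<phi>) (dual_coord \<phi> p) i j k l \<noteq> 0)))"
proof -
  have "C_simplex (Suc (Suc 0)) \<phi>"
    using assms(3) unfolding smooth_simplex_def by blast
  then have diff: "\<phi> differentiable_on open_simplex"
    and diff2: "\<And>w. w \<in> tangent \<Longrightarrow> (\<lambda>p. dderiv \<phi> p w) differentiable_on open_simplex"
    by auto
  define e where "e x = exp (\<phi> (chart x))" for x :: "real ^ 'm"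
  define a where "a x = (\<chi> i. e x * dderiv \<phi> (chart x) (chart_dir (axis i 1)))" for x :: "real ^ 'm"
  define M where "M x = matrix (frechet_derivative a (at x))" for x
  have d\<phi>: "((\<lambda>y. \<phi> (chart y)) has_derivative (\<lambda>v. dderiv \<phi> (chart x) (chart_dir v))) (at x)"
    if "x \<in> solid_simplex" for x
    by (rule has_derivative_in_chart[OF diff that])
  have grad: "e x * dderiv \<phi> (chart x) (chart_dir v) = a x \<bullet> v" if "x \<in> solid_simplex" for x v
  proof -
    interpret L: linear "\<lambda>v. dderiv \<phi> (chart x) (chart_dir v)"
      by (rule has_derivative_linear[OF d\<phi>[OF that]])
    have "v = (\<Sum>i\<in>UNIV. v $ i *\<^sub>R axis i 1)"
      by (simp add: vec_eq_iff axis_nth_kdelta)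
    then have "dderiv \<phi> (chart x) (chart_dir v)
        = dderiv \<phi> (chart x) (chart_dir (\<Sum>i\<in>UNIV. v $ i *\<^sub>R axis i 1))"
      by simp
    also have "\<dots> = (\<Sum>i\<in>UNIV. v $ i * dderiv \<phi> (chart x) (chart_dir (axis i 1)))"
      by (simp only: L.sum L.scale real_scaleR_def)
    finally show ?thesis
      by (simp add: a_def inner_vec_def sum_distrib_left mult_ac)
  qed
  have de: "(e has_derivative (\<lambda>v. a x \<bullet> v)) (at x)" if x: "x \<in> solid_simplex" for x
    unfolding grad[OF x, symmetric] unfolding e_def
    by (auto intro!: derivative_eq_intros d\<phi>[OF x])
  have da: "(a has_derivative (\<lambda>v. M x *v v)) (at x)" if x: "x \<in> solid_simplex" for x
  proof -
    have "a differentiable (at x)"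
      unfolding a_def differentiable_componentwise_within[of "\<lambda>x. \<chi> i. f i x" for f]
        Basis_vec_def
      using has_derivative_in_chart[OF diff2[OF chart_dir_tangent] x] de[OF x]
      by (auto simp: inner_axis intro!: differentiable_mult intro: differentiableI)
    then have fd: "(a has_derivative frechet_derivative a (at x)) (at x)"
      by (simp add: frechet_derivative_works)
    from fd matrix_vector_mul(2)[OF has_derivative_linear[OF fd]] show ?thesis
      by (simp add: M_def)
  qed
  interpret strictly_concave_potential e a M
  proof
    fix x v :: "real ^ 'm"
    assume x: "x \<in> solid_simplex"
    show "e x > 0"
      by (simp add: e_def)
    show "(e has_derivative (\<lambda>v. a x \<bullet> v)) (at x)" "(a has_derivative (\<lambda>v. M x *v v)) (at x)"
      by (rule de[OF x] da[OF x])+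
    assume "v \<noteq> 0"
    then have "chart_dir v \<noteq> 0"
      by (metis chart_dir_nth(1) vec_eq_iff zero_index)
    then have "hessian (\<lambda>q. exp (\<phi> q)) (chart x) (chart_dir v) (chart_dir v) < 0"
      using assms(5)[OF chart_in_open_simplex[OF x]] chart_dir_tangent by (auto simp: neg_def_hessian_def)
    also have "hessian (\<lambda>q. exp (\<phi> q)) (chart x) (chart_dir v) (chart_dir v)
        = dderiv (\<lambda>y. dderiv e y v) x v"
      unfolding hessian_def dderiv_chart e_def ..
    also have "\<dots> = dderiv (\<lambda>y. a y \<bullet> v) x v"
      by (rule dderiv_cong_open[OF open_solid_simplex x]) (rule dderiv_eq[OF de])
    also have "\<dots> = v \<bullet> (M x *v v)"
      using dderiv_eq[OF has_derivative_inner_left[OF da[OF x]]] by (simp add: inner_commute)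
    finally show "v \<bullet> (M x *v v) < 0" .
  qed
  have slope: "1 + dderiv \<phi> (chart x) (chart_dir (y - x)) = tangent_plane x y / e x"
    if "x \<in> solid_simplex" for x y
    using grad[OF that, of "y - x"] e_pos[OF that] by (simp add: tangent_plane_def field_simps)
  have L_div: "L_div \<phi> (simplex_point \<theta>) (simplex_point \<theta>') = divergence (softmax \<theta>) (softmax \<theta>')" for \<theta> \<theta>'
  proof -
    define x y where "x = softmax \<theta>'" and "y = softmax \<theta>"
    have x: "x \<in> solid_simplex" and y: "y \<in> solid_simplex"
      by (simp_all add: x_def y_def softmax_in_solid_simplex)
    have "tangent_plane x y > 0"
      using below_tangent_plane[OF x y] e_pos[OF x] e_pos[OF y] by (cases "x = y") auto
    then have "L_div \<phi> (chart y) (chart x) = ln (tangent_plane x y) - ln (e x) - (\<phi> (chart y) - \<phi> (chart x))"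
      unfolding L_div_def chart_diff slope[OF x] using e_pos[OF x] by (simp add: ln_divide_pos)
    then show ?thesis
      by (simp add: divergence_def simplex_point_def e_def flip: x_def y_def)
  qed
  have dual: "dual_coord \<phi> (simplex_point \<theta>) = dual_map \<theta>" for \<theta>
  proof -
    define x where "x = softmax \<theta>"
    have x: "x \<in> solid_simplex"
      by (simp add: x_def softmax_in_solid_simplex)
    have x': "x $ i > 0" "1 - (\<Sum>j\<in>UNIV. x $ j) > 0" for i
      using x by (auto simp: solid_simplex_def)
    note pos = heights_pos[OF x] e_pos[OF x]
    have ax: "axis (Some i) 1 = chart (axis i 1)" "axis None 1 = chart 0" for i :: 'm
      using sum_kdelta(2)[of i "\<lambda>_. 1"] by (simp_all add: vec_option_eq_iff axis_nth_kdelta) (simp_all add: kdelta_def)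
    have "portfolio \<phi> (chart x) $ Some i = x $ i * (axis_height x $ i / e x)" for i
      unfolding portfolio_def axis_height_def by (simp add: ax chart_diff slope[OF x])
    moreover have "portfolio \<phi> (chart x) $ None = (1 - (\<Sum>j\<in>UNIV. x $ j)) * (origin_height x / e x)"
      unfolding portfolio_def origin_height_def using slope[OF x, of 0] by (simp add: ax chart_diff)
    ultimately have "portfolio \<phi> (chart x) $ Some i / portfolio \<phi> (chart x) $ None
        = (x $ i / (1 - (\<Sum>j\<in>UNIV. x $ j))) / (origin_height x / axis_height x $ i)" for i
      using pos by simp
    then have "ln (portfolio \<phi> (chart x) $ Some i / portfolio \<phi> (chart x) $ None)
        = ln (x $ i / (1 - (\<Sum>j\<in>UNIV. x $ j))) - ln (origin_height x / axis_height x $ i)" for i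
      by (simp only:) (rule ln_divide_pos; use pos x' in auto)
    then show ?thesis
      by (simp add: dual_coord_def primal_coord_def dual_map_def simplex_point_def vec_eq_iff flip: x_def)
  qed
  note primal_rep = coordinate_representation[of primal_coord "\<lambda>\<theta>. \<theta>", OF primal_coord_simplex_point inj_on_id2]
  note dual_rep = coordinate_representation[OF dual inj_dual_map]
  have D\<theta>: "D\<theta> b c = divergence (softmax b) (softmax c)" for b c
    by (simp add: D\<theta>_def div_in_coord_def primal_rep(2) L_div)
  have D\<phi>: "D\<phi> (dual_map b) (dual_map c) = divergence (softmax b) (softmax c)" for b c
    by (simp add: D\<phi>_def div_in_coord_def dual_rep(2) L_div)
  note primal = primal_curvature[OF D\<theta>] and dual_curv = dual_curvature[OF D\<phi>]
  show ?thesis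
  proof (intro conjI impI ballI allI)
    fix x i j k l
    show "curv_coeff (primal_conn D\<theta>) x i j k l =
        kdelta l j * div_metric D\<theta> x $ i $ k - kdelta l i * div_metric D\<theta> x $ j $ k"
      by (rule primal(2))
  next
    fix x i j k l
    assume "x \<in> dual_coord \<phi> ` open_simplex"
    then obtain \<theta> where "x = dual_map \<theta>"
      by (auto simp: dual_rep(1))
    then show "curv_coeff (dual_conn D\<phi>) x i j k l =
        kdelta l j * div_metric D\<phi> x $ i $ k - kdelta l i * div_metric D\<phi> x $ j $ k"
      by (simp add: dual_curv(2))
  next
    fix p :: "real ^ ('m option)"
    assume card: "3 \<le> CARD('m option)" and p: "p \<in> open_simplex"
    obtain \<theta> where \<theta>: "p = simplex_point \<theta>"
      using p by (rule open_simplex_eq_simplex_point)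
    show "\<exists>i j k l. curv_coeff (primal_conn D\<theta>) (primal_coord p) i j k l \<noteq> 0"
      by (rule constant_curvature_form_nonzero[OF primal(2,1) card])
    show "\<exists>i j k l. curv_coeff (dual_conn D\<phi>) (dual_coord \<phi> p) i j k l \<noteq> 0"
      unfolding \<theta> dual by (rule constant_curvature_form_nonzero[OF dual_curv(2,1) card])
  qed
qed

end
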